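(* Suppose $(X,d)$ is a complete metric space which is doubling and annularly linearly connected, i.e. $N$-doubling and $L$-annularly linearly connected for some constants $N$ and $L \geq 1$. Then the conformal dimension $\dim_{\mathcal{C}}(X)$ is at least $C > 1$, where $C$ depends only on the constants $N$ and $L$ associated to these two conditions.
   Context: A metric space is $N$-doubling if every ball can be covered using $N$ balls of half the radius; it is doubling if it is $N$-doubling for some $N$. For $p \in X$ and $0 < r \leq R$ let $A(p,r,R) = \overline{B}(p,R) \setminus B(p,r)$ (closed ball minus open ball). A metric space $X$ is $L$-annularly linearly connected, for some $L \geq 1$, if it is connected and complete, and whenever $p \in X$ and $x,y \in A(p,r,2r)$ for some $r > 0$, there exists an arc $J$ joining $x$ to $y$ that lies in the annulus $A(p, \frac{r}{L}, 2Lr)$. It is annularly linearly connected if this holds for some $L \geq 1$. A homeomorphism $f:(X,d)\to(Y,d')$ is quasi-symmetric if there is a homeomorphism $\eta:[0,\infty)\to[0,\infty)$ with $d'(f(x),f(a)) \leq \eta(t)\, d'(f(x),f(b))$ whenever $d(x,a) \leq t\, d(x,b)$; then $X$ and $Y$ are called quasi-symmetric. The conformal dimension $\dim_{\mathcal{C}}(X)$ is the infimum of the Hausdorff dimensions of all metric spaces quasi-symmetric to $X$. *)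

theory Defs
  imports "HOL-Analysis.Analysis"
begin

section \<open>Doubling and annularly linearly connected metric spaces\<close>

text \<open>Balls in the doubling condition are open and of positive radius; the \<open>N\<close> smaller balls
  have their centres in the space, and repetitions are allowed (hence \<open>card F \<le> N\<close>).\<close>

definition doubling :: "nat \<Rightarrow> 'a metric \<Rightarrow> bool" where
  "doubling N X \<longleftrightarrow>
     (\<forall>x\<in>mspace X. \<forall>r>0. \<exists>F. F \<subseteq> mspace X \<and> finite F \<and> card F \<le> N \<and>
        mball_of X x r \<subseteq> (\<Union>y\<in>F. mball_of X y (r / 2)))"

definition annulus :: "'a metric \<Rightarrow> 'a \<Rightarrow> real \<Rightarrow> real \<Rightarrow> 'a set" where
  "annulus X p r R = mcball_of X p R - mball_of X p r"

definition arc_joining :: "'a metric \<Rightarrow> 'a \<Rightarrow> 'a \<Rightarrow> 'a set \<Rightarrow> bool" where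
  "arc_joining X x y J \<longleftrightarrow>
     (\<exists>g. embedding_map (top_of_set {0..1::real}) (mtopology_of X) g \<and>
          g 0 = x \<and> g 1 = y \<and> g ` {0..1} = J)"

text \<open>The case \<open>x = y\<close> is left out: no injective arc joins a point to itself, and the degenerate
  arc \<open>{x}\<close> trivially lies in the larger annulus.\<close>

definition annularly_linearly_connected :: "real \<Rightarrow> 'a metric \<Rightarrow> bool" where
  "annularly_linearly_connected L X \<longleftrightarrow>
     L \<ge> 1 \<and> connected_space (mtopology_of X) \<and> mcomplete_of X \<and>
     (\<forall>p\<in>mspace X. \<forall>r>0. \<forall>x\<in>annulus X p r (2 * r). \<forall>y\<in>annulus X p r (2 * r). x \<noteq> y \<longrightarrow>
        (\<exists>J. arc_joining X x y J \<and> J \<subseteq> annulus X p (r / L) (2 * L * r)))"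

section \<open>Hausdorff dimension\<close>

definition ediam :: "'a metric \<Rightarrow> 'a set \<Rightarrow> ennreal" where
  "ediam X U = (SUP x\<in>U. SUP y\<in>U. ennreal (mdist X x y))"

text \<open>The \<open>s\<close>-th power of the diameter. The case distinction implements \<open>0\<^sup>0 = 1\<close> for nonempty
  sets, whereas \<open>0 powr 0 = 0\<close>; it is only applied to sets of finite diameter.\<close>

definition diam_power :: "'a metric \<Rightarrow> real \<Rightarrow> 'a set \<Rightarrow> ennreal" where
  "diam_power X s U =
     (if U = {} then 0 else if s = 0 then 1 else ennreal (enn2real (ediam X U) powr s))"

definition hausdorff_content :: "'a metric \<Rightarrow> real \<Rightarrow> real \<Rightarrow> ennreal" where
  "hausdorff_content X s \<delta> =
     (INF U \<in> {U :: nat \<Rightarrow> 'a set. mspace X \<subseteq> (\<Union>i. U i) \<and>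
                 (\<forall>i. U i \<subseteq> mspace X \<and> ediam X (U i) \<le> ennreal \<delta>)}.
        (\<Sum>i. diam_power X s (U i)))"

definition hausdorff_measure :: "'a metric \<Rightarrow> real \<Rightarrow> ennreal" where
  "hausdorff_measure X s = (SUP \<delta>\<in>{0<..}. hausdorff_content X s \<delta>)"

definition hausdorff_dim :: "'a metric \<Rightarrow> ennreal" where
  "hausdorff_dim X = (INF s \<in> {s. 0 \<le> s \<and> hausdorff_measure X s = 0}. ennreal s)"

section \<open>Quasi-symmetric maps and conformal dimension\<close>

definition quasi_symmetric_map :: "'a metric \<Rightarrow> 'b metric \<Rightarrow> ('a \<Rightarrow> 'b) \<Rightarrow> bool" where
  "quasi_symmetric_map X Y f \<longleftrightarrow>
     homeomorphic_map (mtopology_of X) (mtopology_of Y) f \<and>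
     (\<exists>\<eta>::real \<Rightarrow> real. (\<exists>\<theta>. homeomorphism {0..} {0..} \<eta> \<theta>) \<and>
        (\<forall>x\<in>mspace X. \<forall>a\<in>mspace X. \<forall>b\<in>mspace X. \<forall>t\<ge>0.
           mdist X x a \<le> t * mdist X x b \<longrightarrow>
           mdist Y (f x) (f a) \<le> \<eta> t * mdist Y (f x) (f b)))"

definition quasi_symmetric :: "'a metric \<Rightarrow> 'b metric \<Rightarrow> bool" where
  "quasi_symmetric X Y \<longleftrightarrow> (\<exists>f. quasi_symmetric_map X Y f)"

text \<open>The infimum ranges over metric spaces \<open>Y\<close> whose points have the same type as those of \<open>X\<close>.
  Nothing is lost: a space quasi-symmetric to \<open>X\<close> is in bijection with \<open>mspace X\<close>, so it has an
  isometric copy with carrier \<open>mspace X\<close>, with the same Hausdorff dimension.\<close>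

definition conformal_dim :: "'a metric \<Rightarrow> ennreal" where
  "conformal_dim X = (INF Y \<in> {Y :: 'a metric. quasi_symmetric X Y}. hausdorff_dim Y)"

text \<open>\<open>C\<close> is a lower bound for the conformal dimension, uniform over all spaces with constants
  \<open>N\<close>, \<open>L\<close> and points of type \<open>'a\<close>. Spaces with at most one point satisfy the doubling and annular
  conditions vacuously and have dimension 0, so they have to be excluded.\<close>

definition conformal_dim_bound :: "'a itself \<Rightarrow> nat \<Rightarrow> real \<Rightarrow> real \<Rightarrow> bool" where
  "conformal_dim_bound _ N L C \<longleftrightarrow>
     (\<forall>X :: 'a metric.
        (\<exists>x\<in>mspace X. \<exists>y\<in>mspace X. x \<noteq> y) \<and>
        mcomplete_of X \<and> doubling N X \<and> annularly_linearly_connected L X \<longrightarrow>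
        conformal_dim X \<ge> ennreal C)"

text \<open>In ``there is \<open>C > 1\<close> such that for all metric spaces'', the point type \<open>'a\<close> of the spaces
  cannot be quantified inside the formula, and a bare
  \<open>\<exists>C>1. conformal_dim_bound TYPE('a) N L C\<close> would let \<open>C\<close> vary with \<open>'a\<close>. To have \<open>C\<close> depend on \<open>N\<close>
  and \<open>L\<close> only, one obtains \<open>C\<close> from the spaces with points in the fixed type \<^typ>\<open>real\<close> and says
  separately that any such \<open>C\<close> serves spaces over an arbitrary type \<open>'a\<close>. (Complete doubling spaces
  are separable, hence have at most continuum many points.)\<close>

end

theory Submission
  imports Defs
begin

text \<open>
  Suppose that a space \<open>Y\<close> quasi-symmetric to \<open>X\<close> has vanishing Hausdorff measure in a dimension
  slightly above 1. Then it has coverings by balls of radii \<open>r\<^sub>i\<close> such that the sum of \<open>r\<^sub>i\<^sup>C\<close> is as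
  small as desired, for a fixed \<open>C > 1\<close>. On the other hand, the balls that meet a connected set of
  diameter \<open>c\<close> satisfy \<open>\<Sum> 2 r\<^sub>i \<ge> c\<close>. The contradiction comes from a connected set of definite
  diameter that meets only balls of small total radius.

  Such a set is found in \<open>X\<close>, where the preimages of the balls look like balls of radii
  \<open>s / 2\<^bsup>j k\<^sub>i\<^esup>\<close>. One starts with an arc and modifies it scale by scale. At each scale, a net of the
  space is split into \<open>M\<close> colour classes whose points are far from each other compared with the
  mesh of the net. By annular linear connectivity, the connected set can be rerouted around
  small balls centred at all points of any single colour, without moving far and without
  interference between the detours (lemma \<open>detour\<close>). A random choice of the colour makes every
  given small ball disjoint from the new set with probability at least \<open>1 / M\<close>. Hence a ball of
  depth \<open>k\<close> is met with probability at most \<open>q\<^sup>k\<close>, where \<open>q = 1 - 1 / M\<close>. Choosing at each scale the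
  colour that is best on average yields a single connected set for which the balls that meet it
  have total weight at most \<open>\<Sum> r\<^sub>i q\<^bsup>k\<^sub>i\<^esup>\<close> (lemma \<open>multiscale_avoidance\<close>).

  The doubling property bounds \<open>\<Sum> b\<^bsup>k\<^sub>i\<^esup>\<close> for a small enough \<open>b\<close>, because a Vitali selection makes the
  centres separated (lemma \<open>packing_sum\<close>). Interpolating between this bound and the smallness of
  \<open>\<Sum> r\<^sub>i\<^sup>C\<close> shows that \<open>\<Sum> r\<^sub>i q\<^bsup>k\<^sub>i\<^esup>\<close> is small for \<open>C = 1 + ln q / ln (b / q)\<close> (lemma
  \<open>weight_dichotomy\<close>). The constants \<open>M\<close>, \<open>q\<close>, \<open>b\<close> depend on \<open>N\<close> and \<open>L\<close> only. The distortion function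
  of the quasi-symmetric map affects multiplicative constants but not the exponent, so that \<open>C\<close>
  serves all spaces \<open>Y\<close> at once.

  Finally, a doubling space is separable and therefore has at most as many points as there are
  real numbers. So every such space has an isometric copy whose points are reals, and a bound for
  spaces of reals is a bound for all spaces.
\<close>

section \<open>Detours in annularly linearly connected spaces\<close>

lemma mdist_self [simp]: "x \<in> mspace X \<Longrightarrow> mdist X x x = 0"
  by simp

lemma closedin_mcball_of: "closedin (mtopology_of X) (mcball_of X x r)"
  unfolding mtopology_of_def mcball_of_def
  by (rule Metric_space.closedin_mcball) (rule Metric_space_mspace_mdist)

lemma openin_mball_of: "openin (mtopology_of X) (mball_of X x r)"
  unfolding mtopology_of_def mball_of_def
  by (rule Metric_space.openin_mball) (rule Metric_space_mspace_mdist)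

lemma connectedin_mspace:
  "connectedin (mtopology_of X) S \<Longrightarrow> S \<subseteq> mspace X"
  using connectedin_subset_topspace by fastforce

lemma connected_mdist_image:
  assumes "connectedin (mtopology_of X) S" and "z \<in> mspace X"
  shows "connected (mdist X z ` S)"
proof -
  have "continuous_map (mtopology_of X) euclidean (mdist X z)"
    using assms(2) by (rule continuous_on_mdist)
  then have "connectedin euclidean (mdist X z ` S)"
    using assms(1) by (rule connectedin_continuous_map_image)
  then show ?thesis by simp
qed

lemma connected_point_at_distance:
  assumes "connectedin (mtopology_of X) S" and "z \<in> mspace X"
    and "a \<in> S" "b \<in> S" "mdist X z a \<le> r" "r \<le> mdist X z b"
  obtains y where "y \<in> S" "mdist X z y = r"
proof -
  have "r \<in> mdist X z ` S"
    using connectedD_interval[OF connected_mdist_image[OF assms(1,2)]] assms by blast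
  then show thesis using that by blast
qed

lemma arc_joining_connectedin:
  assumes "arc_joining X x y J"
  shows "connectedin (mtopology_of X) J" "x \<in> J" "y \<in> J"
proof -
  obtain g where g: "embedding_map (top_of_set {0..1::real}) (mtopology_of X) g"
    "g 0 = x" "g 1 = y" "g ` {0..1} = J"
    using assms by (auto simp: arc_joining_def)
  have "connectedin (top_of_set {0..1::real}) {0..1}"
    by (simp add: connectedin_subtopology)
  moreover have "continuous_map (top_of_set {0..1}) (mtopology_of X) g"
    using g(1) unfolding embedding_map_def
    by (meson continuous_map_in_subtopology homeomorphic_imp_continuous_map)
  ultimately show "connectedin (mtopology_of X) J"
    using connectedin_continuous_map_image g(4) by metis
  show "x \<in> J" "y \<in> J" using g by force+
qed

text \<open>Annular linear connectivity enters through this form: the union of the arcs from one point of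
  \<open>S\<close> to all the others is connected.\<close>

lemma annular_connected_hull:
  assumes alc: "annularly_linearly_connected L X"
    and p: "p \<in> mspace X" and r: "r > 0" and S: "S \<subseteq> annulus X p r (2 * r)"
  obtains T where "connectedin (mtopology_of X) T" "S \<subseteq> T"
    "T \<subseteq> annulus X p (r / L) (2 * L * r)" "S = {} \<longrightarrow> T = {}"
proof (cases "S = {}")
  case True
  then show ?thesis using that[of "{}"] by simp
next
  case False
  then obtain x where x: "x \<in> S" by blast
  have L: "L \<ge> 1" using alc by (simp add: annularly_linearly_connected_def)
  have "r / L \<le> r" using L r by (simp add: divide_le_eq)
  moreover have "2 * r \<le> 2 * L * r" using L r by simp
  ultimately have S': "S \<subseteq> annulus X p (r / L) (2 * L * r)"
    using S by (force simp: annulus_def)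
  have "\<exists>J. connectedin (mtopology_of X) J \<and> x \<in> J \<and> y \<in> J \<and> J \<subseteq> annulus X p (r / L) (2 * L * r)"
    if y: "y \<in> S" for y
  proof (cases "x = y")
    case True
    have "x \<in> mspace X" using x S by (auto simp: annulus_def)
    then show ?thesis
      using x S' True by (intro exI[of _ "{x}"]) auto
  next
    case False
    have "x \<in> annulus X p r (2 * r)" "y \<in> annulus X p r (2 * r)" using x y S by auto
    then obtain J where "arc_joining X x y J" "J \<subseteq> annulus X p (r / L) (2 * L * r)"
      using alc p r False unfolding annularly_linearly_connected_def by blast
    then show ?thesis using arc_joining_connectedin[of X x y J] by auto
  qed
  then obtain J where J: "\<And>y. y \<in> S \<Longrightarrow> connectedin (mtopology_of X) (J y) \<and> x \<in> J y \<and> y \<in> J y \<and>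
      J y \<subseteq> annulus X p (r / L) (2 * L * r)"
    by metis
  show ?thesis
  proof (rule that[of "\<Union>y\<in>S. J y"])
    show "connectedin (mtopology_of X) (\<Union>y\<in>S. J y)"
    proof (rule connectedin_Union)
      show "connectedin (mtopology_of X) K" if "K \<in> J ` S" for K
        using that J by auto
      show "\<Inter>(J ` S) \<noteq> {}" using x J by auto
    qed
  qed (use J False in auto)
qed

text \<open>Inside each ball \<open>B(z, r)\<close> the set \<open>G\<close> is deleted and replaced by a connected set \<open>T z\<close>
  that lies in a larger annulus and contains all points of \<open>G\<close> with \<open>r \<le> d(z, x) \<le> 2 r\<close>. The result is connected:
  a separation of it puts each \<open>T z\<close> on one side, and assigning \<open>G \<inter> B(z, 2 r)\<close> to the side
  of \<open>T z\<close> gives a separation of \<open>G\<close>. The points of \<open>Z\<close> are so far apart that the replacement made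
  around one of them stays clear of the balls around the others. The points \<open>a\<close> and \<open>b\<close> ensure that
  \<open>G\<close> is not contained in one of the deleted balls.\<close>

lemma detour:
  assumes alc: "annularly_linearly_connected L X"
    and con: "connectedin (mtopology_of X) G"
    and r: "r > 0" and Z: "finite Z" "Z \<subseteq> mspace X"
    and sep: "\<forall>z\<in>Z. \<forall>w\<in>Z. z \<noteq> w \<longrightarrow> 4 * L * r \<le> mdist X z w"
    and ab: "a \<in> G" "b \<in> G" "2 * r \<le> mdist X a b"
  shows "\<exists>G'. connectedin (mtopology_of X) G' \<and> (\<forall>z\<in>Z. G' \<inter> mball_of X z (r / L) = {}) \<and>
    (\<forall>y\<in>G'. \<exists>x\<in>G. mdist X x y \<le> (2 * L + 2) * r) \<and> (\<forall>x\<in>G. \<exists>y\<in>G'. mdist X x y \<le> 3 * r)"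
proof -
  have L: "L \<ge> 1" using alc by (simp add: annularly_linearly_connected_def)
  have rL: "r / L \<le> r" using L r by (simp add: divide_le_eq)
  have Lr: "r \<le> L * r" using L r by simp
  have G: "G \<subseteq> mspace X" using con by (rule connectedin_mspace)
  have tri: "mdist X x z \<le> mdist X x y + mdist X y z"
    if "x \<in> mspace X" "y \<in> mspace X" "z \<in> mspace X" for x y z
    using that by (rule mdist_triangle)
  have sep': "z = w" if "z \<in> Z" "w \<in> Z" "x \<in> mspace X" "mdist X z x < 2 * r" "mdist X w x \<le> 2 * r" for z w x
  proof (rule ccontr)
    assume "z \<noteq> w"
    then have "4 * L * r \<le> mdist X z w" using sep that by blast
    moreover have "mdist X z w \<le> mdist X z x + mdist X w x"
      using tri[of z x w] that Z by (auto simp: mdist_commute)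
    ultimately show False using that Lr by linarith
  qed
  define A where "A z = G \<inter> annulus X z r (2 * r)" for z
  have Aiff: "x \<in> A z \<longleftrightarrow> x \<in> G \<and> r \<le> mdist X z x \<and> mdist X z x \<le> 2 * r" if "z \<in> Z" for x z
    using that Z G by (auto simp: A_def annulus_def)
  have "\<forall>z\<in>Z. \<exists>T. connectedin (mtopology_of X) T \<and> A z \<subseteq> T \<and> T \<subseteq> annulus X z (r / L) (2 * L * r)
      \<and> (A z = {} \<longrightarrow> T = {})"
  proof
    fix z assume "z \<in> Z"
    then have z: "z \<in> mspace X" using Z by auto
    have "A z \<subseteq> annulus X z r (2 * r)" by (auto simp: A_def)
    from annular_connected_hull[OF alc z r this]
    show "\<exists>T. connectedin (mtopology_of X) T \<and> A z \<subseteq> T \<and> T \<subseteq> annulus X z (r / L) (2 * L * r)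
        \<and> (A z = {} \<longrightarrow> T = {})" by metis
  qed
  then obtain T where T: "\<And>z. z \<in> Z \<Longrightarrow> connectedin (mtopology_of X) (T z)"
    "\<And>z. z \<in> Z \<Longrightarrow> A z \<subseteq> T z" "\<And>z. z \<in> Z \<Longrightarrow> T z \<subseteq> annulus X z (r / L) (2 * L * r)"
    "\<And>z. z \<in> Z \<Longrightarrow> A z = {} \<Longrightarrow> T z = {}"
    by metis
  have T3: "y \<in> mspace X" "r / L \<le> mdist X z y" "mdist X z y \<le> 2 * L * r" if "z \<in> Z" "y \<in> T z" for z y
    using T(3)[OF that(1)] that by (auto simp: annulus_def)
  have meets: "A z \<noteq> {}" if z: "z \<in> Z" and x: "x \<in> G" "mdist X z x < 2 * r" for z x
  proof (cases "mdist X z x < r")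
    case False
    then show ?thesis using x z Aiff by force
  next
    case True
    have zX: "z \<in> mspace X" using z Z by auto
    \<comment> \<open>\<open>G\<close> is too large to lie inside the ball, so it crosses the sphere around \<open>z\<close>.\<close>
    have "mdist X a b \<le> mdist X z a + mdist X z b"
      using tri[of a z b] ab zX G by (auto simp: mdist_commute)
    then obtain c where "c \<in> G" "r \<le> mdist X z c" using ab by (smt (verit))
    then obtain y where "y \<in> G" "mdist X z y = r"
      using connected_point_at_distance[OF con zX x(1), of c r] True by auto
    then show ?thesis using Aiff[OF z, of y] r by auto
  qed
  define G' where "G' = (G - (\<Union>z\<in>Z. mball_of X z r)) \<union> (\<Union>z\<in>Z. T z)"
  have G'X: "G' \<subseteq> mspace X" using G T3 by (auto simp: G'_def)
  have keep: "x \<in> G'" if "x \<in> G" "\<And>z. z \<in> Z \<Longrightarrow> r \<le> mdist X z x" for x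
    using that by (fastforce simp: G'_def)
  have "connectedin (mtopology_of X) G'"
    unfolding connectedin
  proof (intro conjI notI)
    show "G' \<subseteq> topspace (mtopology_of X)" using G'X by simp
    assume "\<exists>E1 E2. openin (mtopology_of X) E1 \<and> openin (mtopology_of X) E2 \<and> G' \<subseteq> E1 \<union> E2 \<and>
          E1 \<inter> E2 \<inter> G' = {} \<and> E1 \<inter> G' \<noteq> {} \<and> E2 \<inter> G' \<noteq> {}"
    then obtain E1 E2 where E12: "openin (mtopology_of X) E1" "openin (mtopology_of X) E2"
      "G' \<subseteq> E1 \<union> E2" "E1 \<inter> E2 \<inter> G' = {}" "E1 \<inter> G' \<noteq> {}" "E2 \<inter> G' \<noteq> {}"
      by blast
    define E where "E i = (if i then E1 else E2)" for i
    have E: "openin (mtopology_of X) (E True)" "openin (mtopology_of X) (E False)"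
      "G' \<subseteq> E True \<union> E False" "E True \<inter> E False \<inter> G' = {}" "E True \<inter> G' \<noteq> {}" "E False \<inter> G' \<noteq> {}"
      using E12 by (simp_all add: E_def)
    have Eo: "openin (mtopology_of X) (E i)" and Ene: "E i \<inter> G' \<noteq> {}" for i using E by (cases i; simp)+
    have Edisj: "i = j" if "x \<in> E i" "x \<in> E j" "x \<in> G'" for i j x
    proof (rule ccontr)
      assume "i \<noteq> j"
      then have "x \<in> E True" "x \<in> E False" using that by (cases i; cases j; simp)+
      then show False using E(4) that(3) by blast
    qed
    \<comment> \<open>Each \<open>T z\<close> lies on one side; give the whole ball around \<open>z\<close> to that side.\<close>
    have "\<exists>i. T z \<subseteq> E i" if z: "z \<in> Z" for z
    proof (rule ccontr)
      assume "\<not> ?thesis"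
      then have n: "\<not> T z \<subseteq> E True" "\<not> T z \<subseteq> E False" by blast+
      have sub: "T z \<subseteq> G'" using z by (auto simp: G'_def)
      have "E True \<inter> T z \<noteq> {}" "E False \<inter> T z \<noteq> {}" "T z \<subseteq> E True \<union> E False"
         "E True \<inter> E False \<inter> T z = {}"
        using n sub E by blast+
      then show False using T(1)[OF z] E(1,2) unfolding connectedin by blast
    qed
    then obtain side where side: "\<And>z. z \<in> Z \<Longrightarrow> T z \<subseteq> E (side z)" by metis
    define W where "W i = (E i - (\<Union>z\<in>Z. mcball_of X z r)) \<union> (\<Union>z\<in>{z\<in>Z. side z = i}. mball_of X z (2 * r))" for i
    have cl: "closedin (mtopology_of X) (\<Union>z\<in>Z. mcball_of X z r)"
      using Z by (intro closedin_Union) (auto intro: closedin_mcball_of)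
    have Wo: "openin (mtopology_of X) (W i)" for i
      unfolding W_def using cl Eo
      by (intro openin_Un openin_diff openin_Union) (auto intro: openin_mball_of)
    have Wball: "x \<in> W (side z)" if "z \<in> Z" "x \<in> G" "mdist X z x < 2 * r" for x z
      using that Z G by (auto simp: W_def)
    have Wside: "side z = i" if z: "z \<in> Z" "mdist X z x < 2 * r" and x: "x \<in> G" "x \<in> W i" for x z i
    proof (cases "\<exists>w\<in>Z. side w = i \<and> mdist X w x < 2 * r")
      case True
      then show ?thesis using sep' z x G by force
    next
      case False
      then have xE: "x \<in> E i" "x \<notin> (\<Union>z\<in>Z. mcball_of X z r)" using x by (auto simp: W_def)
      then have "r \<le> mdist X z x" using z x Z G by force
      then have "x \<in> T z" using T(2)[of z] Aiff[of z x] z x by auto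
      then have "x \<in> E (side z)" "x \<in> G'" using side[of z] z by (auto simp: G'_def)
      then show ?thesis using Edisj[of x "side z" i] xE by blast
    qed
    have Wfar: "x \<in> E i \<and> x \<in> G'" if "x \<in> G" "x \<in> W i" "\<And>z. z \<in> Z \<Longrightarrow> 2 * r \<le> mdist X z x" for x i
      using that keep[of x] r by (fastforce simp: W_def)
    have sideG: "G \<inter> W i \<noteq> {}" for i
    proof -
      obtain y where y: "y \<in> E i" "y \<in> G'" using Ene by blast
      consider (inT) z where "z \<in> Z" "y \<in> T z"
        | (ball) z where "z \<in> Z" "y \<in> G" "mdist X z y < 2 * r" "r \<le> mdist X z y"
        | (far) "y \<in> G" "\<And>z. z \<in> Z \<Longrightarrow> 2 * r \<le> mdist X z y"
      proof (cases "\<exists>z\<in>Z. y \<in> T z")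
        case False
        then have *: "y \<in> G" "y \<notin> mball_of X z r" if "z \<in> Z" for z
          using y that by (auto simp: G'_def)
        have **: "r \<le> mdist X z y" if "z \<in> Z" for z
          using *(2)[OF that] *(1)[OF that] that Z G by (auto simp: not_less)
        have "y \<in> G" using y False by (auto simp: G'_def)
        then show thesis using ball far ** by (meson not_le)
      qed (use inT in blast)
      then show ?thesis
      proof cases
        case inT
        have "side z = i" using side y Edisj inT by blast
        obtain x where x: "x \<in> A z" using T(4) inT by blast
        have xG: "x \<in> G" "x \<in> T z" using x T(2)[OF inT(1)] by (auto simp: A_def)
        have dx: "r \<le> mdist X z x" "mdist X z x \<le> 2 * r" using x Aiff[OF inT(1)] by auto
        show ?thesis
        proof (cases "mdist X z x < 2 * r")
          case True
          then have "x \<in> W i" using Wball[OF inT(1) xG(1)] \<open>side z = i\<close> by simp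
          then show ?thesis using xG by blast
        next
          case False
          then have d2: "mdist X z x = 2 * r" using dx by simp
          have "x \<notin> mcball_of X w r" if w: "w \<in> Z" for w
          proof
            assume "x \<in> mcball_of X w r"
            then have "mdist X w x < 2 * r" using r by auto
            then have "w = z" using sep'[of w z x] w inT(1) xG G dx by auto
            then show False using \<open>mdist X w x < 2 * r\<close> d2 by simp
          qed
          moreover have "x \<in> E i" using side[OF inT(1)] xG \<open>side z = i\<close> by auto
          ultimately have "x \<in> W i" by (auto simp: W_def)
          then show ?thesis using xG by blast
        qed
      next
        case ball
        then have "y \<in> T z" using T(2)[of z] Aiff[of z y] ball by auto
        then have "side z = i" using side[of z] y Edisj[of y "side z" i] ball(1) by blast
        then show ?thesis using Wball[of z y] ball by blast
      next
        case far
        then have "y \<in> W i" using y r by (fastforce simp: W_def)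
        then show ?thesis using far by blast
      qed
    qed
    have "G \<subseteq> W True \<union> W False"
    proof
      fix x assume x: "x \<in> G"
      show "x \<in> W True \<union> W False"
      proof (cases "\<exists>z\<in>Z. mdist X z x < 2 * r")
        case True
        then obtain z where "z \<in> Z" "mdist X z x < 2 * r" by blast
        then have "x \<in> W (side z)" using Wball x by blast
        then show ?thesis by (cases "side z") auto
      next
        case False
        then have "x \<in> G'" using keep[OF x] r by force
        then obtain i where "x \<in> E i" using E(3) by blast
        then have "x \<in> W i" using False r by (fastforce simp: W_def)
        then show ?thesis by (cases i) auto
      qed
    qed
    moreover have "W True \<inter> W False \<inter> G = {}"
    proof (rule ccontr)
      assume "W True \<inter> W False \<inter> G \<noteq> {}"
      then obtain x where x: "x \<in> G" "x \<in> W True" "x \<in> W False" by blast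
      show False
      proof (cases "\<exists>z\<in>Z. mdist X z x < 2 * r")
        case True
        then show False using Wside x by blast
      next
        case False
        then show False using Wfar[of x] x Edisj[of x True False] by force
      qed
    qed
    moreover have "W True \<inter> G \<noteq> {}" "W False \<inter> G \<noteq> {}"
      using sideG[of True] sideG[of False] by (simp_all add: Int_commute)
    ultimately have "\<exists>E1 E2. openin (mtopology_of X) E1 \<and> openin (mtopology_of X) E2 \<and> G \<subseteq> E1 \<union> E2 \<and>
          E1 \<inter> E2 \<inter> G = {} \<and> E1 \<inter> G \<noteq> {} \<and> E2 \<inter> G \<noteq> {}"
      by (intro exI[of _ "W True"] exI[of _ "W False"] conjI Wo)
    then show False
      using con unfolding connectedin by (elim conjE notE)
  qed
  moreover have "G' \<inter> mball_of X z (r / L) = {}" if z: "z \<in> Z" for z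
  proof -
    have "\<not> mdist X z y < r / L" if y: "y \<in> G'" for y
    proof (cases "y \<in> G \<and> y \<notin> (\<Union>z\<in>Z. mball_of X z r)")
      case True
      then have "r \<le> mdist X z y" using z Z G by force
      then show ?thesis using rL by linarith
    next
      case False
      then obtain w where w: "w \<in> Z" "y \<in> T w" using y by (auto simp: G'_def)
      show ?thesis
      proof (cases "w = z")
        case True
        then show ?thesis using T3[OF w] by auto
      next
        case False
        have "4 * L * r \<le> mdist X z w" using sep z w False by auto
        also have "\<dots> \<le> mdist X z y + mdist X w y"
          using tri[of z y w] z w Z T3[OF w] by (auto simp: mdist_commute)
        finally show ?thesis using T3[OF w] rL Lr by linarith
      qed
    qed
    then show ?thesis by auto
  qed
  moreover have "\<exists>x\<in>G. mdist X x y \<le> (2 * L + 2) * r" if y: "y \<in> G'" for y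
  proof (cases "y \<in> G")
    case True
    then have "mdist X y y = 0" using G by auto
    then show ?thesis using True L r by (intro bexI[of _ y]) auto
  next
    case False
    then obtain z where z: "z \<in> Z" "y \<in> T z" using y by (auto simp: G'_def)
    then obtain x where x: "x \<in> A z" using T(4) by blast
    then have x': "x \<in> G" "mdist X z x \<le> 2 * r" using Aiff z by auto
    have "mdist X x y \<le> mdist X z x + mdist X z y"
      using tri[of x z y] x' z Z G T3[OF z] by (auto simp: mdist_commute)
    also have "\<dots> \<le> (2 * L + 2) * r" using x' T3[OF z] by (simp add: algebra_simps)
    finally show ?thesis using x' by blast
  qed
  moreover have "\<exists>y\<in>G'. mdist X x y \<le> 3 * r" if x: "x \<in> G" for x
  proof (cases "\<exists>z\<in>Z. mdist X z x < r")
    case True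
    then obtain z where z: "z \<in> Z" "mdist X z x < r" by blast
    then obtain y where y: "y \<in> A z" using meets[of z x] x r by auto
    then have y': "y \<in> G" "mdist X z y \<le> 2 * r" using Aiff z by auto
    have "mdist X x y \<le> mdist X z x + mdist X z y"
      using tri[of x z y] y' z Z G x by (auto simp: mdist_commute)
    moreover have "y \<in> G'" using y T(2) z by (auto simp: G'_def)
    ultimately show ?thesis using y' z by (intro bexI[of _ y]) auto
  next
    case False
    then have "x \<in> G'" using keep[OF x] by force
    moreover have "mdist X x x = 0" using x G by auto
    ultimately show ?thesis using r by (intro bexI[of _ x]) auto
  qed
  ultimately show ?thesis by blast
qed

section \<open>Separated sets in doubling spaces\<close>

lemma maximal_separated_subset:
  assumes "finite F" "F \<subseteq> mspace X" "e > 0"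
  obtains Z where "Z \<subseteq> F" "\<And>z w. z \<in> Z \<Longrightarrow> w \<in> Z \<Longrightarrow> z \<noteq> w \<Longrightarrow> e \<le> mdist X z w"
    "\<And>x. x \<in> F \<Longrightarrow> \<exists>z\<in>Z. mdist X z x < e"
proof -
  have "\<exists>Z\<subseteq>F. (\<forall>z\<in>Z. \<forall>w\<in>Z. z \<noteq> w \<longrightarrow> e \<le> mdist X z w) \<and> (\<forall>x\<in>F. \<exists>z\<in>Z. mdist X z x < e)"
    using assms
  proof (induction F rule: finite_induct)
    case empty
    then show ?case by simp
  next
    case (insert x F)
    then obtain Z where Z: "Z \<subseteq> F" "\<forall>z\<in>Z. \<forall>w\<in>Z. z \<noteq> w \<longrightarrow> e \<le> mdist X z w"
      "\<forall>x\<in>F. \<exists>z\<in>Z. mdist X z x < e"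
      by (metis insert_subset)
    show ?case
    proof (cases "\<exists>z\<in>Z. mdist X z x < e")
      case True
      then show ?thesis using Z by (intro exI[of _ Z]) auto
    next
      case False
      have "mdist X x x = 0" using insert.prems by simp
      then show ?thesis
        using Z False insert.prems
        by (intro exI[of _ "insert x Z"]) (auto simp: mdist_commute not_less)
    qed
  qed
  then obtain Z where "Z \<subseteq> F" "\<forall>z\<in>Z. \<forall>w\<in>Z. z \<noteq> w \<longrightarrow> e \<le> mdist X z w"
    "\<forall>x\<in>F. \<exists>z\<in>Z. mdist X z x < e" by blast
  then show thesis by (intro that[of Z]) simp_all
qed

text \<open>Colour the vertices one after the other: fewer than \<open>M\<close> colours are forbidden at each step.\<close>

lemma greedy_colouring:
  assumes "finite V" and "symp R" and "\<forall>v\<in>V. card {u \<in> V. u \<noteq> v \<and> R u v} < M"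
  shows "\<exists>c :: 'a \<Rightarrow> nat. (\<forall>v\<in>V. c v < M) \<and> (\<forall>u\<in>V. \<forall>v\<in>V. u \<noteq> v \<longrightarrow> R u v \<longrightarrow> c u \<noteq> c v)"
  using assms(1,3)
proof (induction V rule: finite_induct)
  case empty
    then show ?case by simp
  next
    case (insert x V)
    have "card {u \<in> V. u \<noteq> v \<and> R u v} < M" if "v \<in> V" for v
      by (rule le_less_trans[OF card_mono insert.prems[rule_format, of v]]) (use insert.hyps that in auto)
    then have "\<forall>v\<in>V. card {u \<in> V. u \<noteq> v \<and> R u v} < M" by (rule ballI)
    from insert.IH[OF this]
    obtain c where c: "\<forall>v\<in>V. c v < M" "\<forall>u\<in>V. \<forall>v\<in>V. u \<noteq> v \<longrightarrow> R u v \<longrightarrow> c u \<noteq> c v"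
      by (elim exE conjE)
    define D where "D = c ` {u \<in> V. R u x}"
    have fD: "finite D" using insert.hyps(1) by (simp add: D_def)
    have "{u \<in> insert x V. u \<noteq> x \<and> R u x} = {u \<in> V. R u x}" using insert.hyps(2) by blast
    then have "card {u \<in> V. R u x} < M" using insert.prems by (metis insertI1)
    then have "card D < M"
      unfolding D_def using card_image_le[of "{u \<in> V. R u x}" c] insert.hyps(1) by simp
    then have "\<not> {..<M} \<subseteq> D" using card_mono[OF fD, of "{..<M}"] by auto
    then obtain m where m: "m < M" "m \<notin> D" by blast
    have D: "c u \<noteq> m" if "u \<in> V" "R u x" for u using that m(2) by (auto simp: D_def)
    show ?case
    proof (intro exI[of _ "c(x := m)"] conjI ballI impI)
      show "(c(x := m)) v < M" if "v \<in> insert x V" for v using that c(1) m(1) by auto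
      fix u v assume uv: "u \<in> insert x V" "v \<in> insert x V" "u \<noteq> v" "R u v"
      have vu: "R v u" using \<open>symp R\<close> uv(4) by (rule sympD)
      consider "u \<noteq> x" "v = x" | "v \<noteq> x" "u = x" | "u \<noteq> x" "v \<noteq> x"
        using uv(3) by blast
      then show "(c(x := m)) u \<noteq> (c(x := m)) v"
      proof cases
        case 1
        then show ?thesis using D[of u] uv by simp
      next
        case 2
        then show ?thesis using D[of v] uv vu by simp
      next
        case 3
        then show ?thesis using c(2) uv by simp
      qed
    qed
qed

lemma doubling_iterate:
  assumes "doubling N X" "x \<in> mspace X" "r > 0"
  shows "\<exists>F. F \<subseteq> mspace X \<and> finite F \<and> card F \<le> N ^ n \<and> mball_of X x r \<subseteq> (\<Union>y\<in>F. mball_of X y (r / 2 ^ n))"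
proof (induction n)
  case 0
  show ?case using assms by (intro exI[of _ "{x}"]) auto
next
  case (Suc n)
  then obtain F where F: "F \<subseteq> mspace X" "finite F" "card F \<le> N ^ n"
    "mball_of X x r \<subseteq> (\<Union>y\<in>F. mball_of X y (r / 2 ^ n))" by blast
  have "\<exists>E. E \<subseteq> mspace X \<and> finite E \<and> card E \<le> N \<and> mball_of X y (r / 2 ^ n) \<subseteq> (\<Union>z\<in>E. mball_of X z (r / 2 ^ n / 2))"
    if "y \<in> F" for y
  proof -
    have "y \<in> mspace X" "r / 2 ^ n > 0" using that F(1) assms(3) by auto
    then show ?thesis using assms(1) unfolding doubling_def by blast
  qed
  then obtain E where E: "\<And>y. y \<in> F \<Longrightarrow> E y \<subseteq> mspace X \<and> finite (E y) \<and> card (E y) \<le> N \<and>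
      mball_of X y (r / 2 ^ n) \<subseteq> (\<Union>z\<in>E y. mball_of X z (r / 2 ^ n / 2))"
    by metis
  have "card (\<Union>(E ` F)) \<le> (\<Sum>y\<in>F. card (E y))" using F by (intro card_UN_le) auto
  also have "\<dots> \<le> card F * N" using sum_bounded_above[of F "\<lambda>y. card (E y)" N] E by simp
  also have "\<dots> \<le> N ^ Suc n" using mult_le_mono1[OF F(3), of N] by (simp add: mult.commute)
  finally have card: "card (\<Union>(E ` F)) \<le> N ^ Suc n" .
  have "mball_of X x r \<subseteq> (\<Union>z\<in>\<Union>(E ` F). mball_of X z (r / 2 ^ n / 2))"
  proof
    fix y assume "y \<in> mball_of X x r"
    then obtain u where "u \<in> F" "y \<in> mball_of X u (r / 2 ^ n)" using F(4) by blast
    then show "y \<in> (\<Union>z\<in>\<Union>(E ` F). mball_of X z (r / 2 ^ n / 2))" using E by blast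
  qed
  moreover have "r / 2 ^ n / 2 = r / 2 ^ Suc n" by simp
  ultimately have "mball_of X x r \<subseteq> (\<Union>z\<in>\<Union>(E ` F). mball_of X z (r / 2 ^ Suc n))" by (simp only:)
  moreover have "\<Union>(E ` F) \<subseteq> mspace X" "finite (\<Union>(E ` F))" using E F by auto
  ultimately show ?case
    using card by blast
qed

text \<open>Cover the ball by \<open>N\<^sup>n\<close> balls of radius at most \<open>e / 2\<close>; each of them contains at most one point
  of \<open>S\<close>.\<close>

lemma doubling_card_separated:
  assumes "doubling N X" "x \<in> mspace X" "r > 0" and S: "S \<subseteq> mball_of X x r"
    and sep: "\<And>y z. y \<in> S \<Longrightarrow> z \<in> S \<Longrightarrow> y \<noteq> z \<Longrightarrow> e \<le> mdist X y z" and n: "2 * r / 2 ^ n \<le> e"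
  shows "finite S" "card S \<le> N ^ n"
proof -
  obtain F where F: "F \<subseteq> mspace X" "finite F" "card F \<le> N ^ n"
    "mball_of X x r \<subseteq> (\<Union>y\<in>F. mball_of X y (r / 2 ^ n))"
    using doubling_iterate[OF assms(1-3), of n] by (elim exE conjE)
  have "\<forall>y\<in>S. \<exists>u\<in>F. y \<in> mball_of X u (r / 2 ^ n)" using S F(4) by blast
  then obtain h where h: "\<And>y. y \<in> S \<Longrightarrow> h y \<in> F" "\<And>y. y \<in> S \<Longrightarrow> y \<in> mball_of X (h y) (r / 2 ^ n)"
    by metis
  have "inj_on h S"
  proof (rule inj_onI, rule ccontr)
    fix y z assume yz: "y \<in> S" "z \<in> S" "h y = h z" "y \<noteq> z"
    have "mdist X y z \<le> mdist X y (h y) + mdist X (h y) z"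
      using h(2)[OF yz(1)] h(2)[OF yz(2)] yz(3) by (intro mdist_triangle) auto
    also have "\<dots> < r / 2 ^ n + r / 2 ^ n"
      using h(2)[OF yz(1)] h(2)[OF yz(2)] yz(3) by (auto simp: mdist_commute intro!: add_strict_mono)
    also have "\<dots> \<le> e" using n by simp
    finally show False using sep[OF yz(1,2,4)] by simp
  qed
  moreover have "h ` S \<subseteq> F" using h by blast
  ultimately show "finite S" "card S \<le> N ^ n"
    using F inj_on_finite[of h S F] card_inj_on_le[of h S F] by linarith+
qed

text \<open>Every \<open>i\<close> is removed by at least one of the \<open>M\<close> colours, so a colour removes at least the fraction
  \<open>1 / M\<close> of the weight on average, and some colour does at least as well as the average.\<close>

lemma good_colour:
  fixes w :: "'i \<Rightarrow> real"
  assumes I: "finite I" and w: "\<forall>i\<in>I. 0 \<le> w i" and M: "M > 0"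
    and killed: "\<forall>i\<in>I. \<exists>c<M. P c i"
  shows "\<exists>c<M. (\<Sum>i\<in>{i\<in>I. \<not> P c i}. w i) \<le> (1 - 1 / real M) * (\<Sum>i\<in>I. w i)"
proof (rule ccontr)
  assume "\<not> ?thesis"
  then have *: "(1 - 1 / real M) * (\<Sum>i\<in>I. w i) < (\<Sum>i\<in>{i\<in>I. \<not> P c i}. w i)" if "c < M" for c
    using that by (meson not_less)
  have split: "(\<Sum>i\<in>I. w i) = (\<Sum>i\<in>{i\<in>I. P c i}. w i) + (\<Sum>i\<in>{i\<in>I. \<not> P c i}. w i)" for c
    using sum.Int_Diff[OF I, of w "{i. P c i}"] by (simp add: Int_def set_diff_eq)
  have "(\<Sum>i\<in>{i\<in>I. P c i}. w i) < (\<Sum>i\<in>I. w i) / M" if "c < M" for c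
    using *[OF that] split[of c] by (simp add: left_diff_distrib)
  then have "(\<Sum>c<M. \<Sum>i\<in>{i\<in>I. P c i}. w i) < (\<Sum>c<M. (\<Sum>i\<in>I. w i) / M)"
    using M by (intro sum_strict_mono) auto
  also have "\<dots> = (\<Sum>i\<in>I. w i)" using M by simp
  also have "\<dots> \<le> (\<Sum>i\<in>I. \<Sum>c\<in>{c\<in>{..<M}. P c i}. w i)"
  proof (rule sum_mono)
    fix i assume i: "i \<in> I"
    then obtain c where "c < M" "P c i" using killed by blast
    then have "w i \<le> (\<Sum>c\<in>{c}. w i)" "{c} \<subseteq> {c\<in>{..<M}. P c i}" by auto
    then show "w i \<le> (\<Sum>c\<in>{c\<in>{..<M}. P c i}. w i)"
      using sum_mono2[of "{c\<in>{..<M}. P c i}" "{c}" "\<lambda>_. w i"] w i by auto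
  qed
  also have "\<dots> = (\<Sum>c<M. \<Sum>i\<in>{i\<in>I. P c i}. w i)"
    using sum.swap_restrict[OF I, of "{..<M}" "\<lambda>i c. w i" "\<lambda>i c. P c i"] by simp
  finally show False by simp
qed

lemma doubling_constant_pos:
  assumes "doubling N X" "x \<in> mspace X"
  shows "N > 0"
proof (rule ccontr)
  assume "\<not> N > 0"
  moreover obtain F where "finite F" "card F \<le> N" "mball_of X x 1 \<subseteq> (\<Union>y\<in>F. mball_of X y (1 / 2))"
    using assms unfolding doubling_def by (meson zero_less_one)
  ultimately have "mball_of X x 1 = {}" by auto
  moreover have "x \<in> mball_of X x 1" using assms(2) by simp
  ultimately show False by blast
qed

section \<open>Connected sets that avoid weighted balls at all scales\<close>

text \<open>A maximal \<open>r / (2 L)\<close>-separated set \<open>Z\<close> of centres is coloured so that points of equal colour are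
  at distance at least \<open>4 L r\<close>, as detours require. The doubling condition bounds the number of
  colours by \<open>N\<^sup>j\<close>. Every centre \<open>x i\<close> is within \<open>r / (2 L)\<close> of some \<open>z \<in> Z\<close>, and a detour around
  \<open>B(z, r / L)\<close> avoids \<open>B(x i, r / (2 L))\<close>. Take the detour for the best colour.\<close>

lemma one_scale_avoidance:
  fixes w :: "'i \<Rightarrow> real"
  assumes alc: "annularly_linearly_connected L X" and dbl: "doubling N X" and j: "16 * L\<^sup>2 \<le> 2 ^ j"
    and con: "connectedin (mtopology_of X) G" and r: "r > 0"
    and ab: "a \<in> G" "b \<in> G" "2 * r \<le> mdist X a b"
    and I: "finite I" "\<forall>i\<in>I. x i \<in> mspace X" "\<forall>i\<in>I. 0 \<le> w i"
  shows "\<exists>G'. connectedin (mtopology_of X) G' \<and>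
    (\<forall>y\<in>G'. \<exists>u\<in>G. mdist X u y \<le> (2 * L + 2) * r) \<and> (\<forall>u\<in>G. \<exists>y\<in>G'. mdist X u y \<le> 3 * r) \<and>
    (\<Sum>i\<in>{i\<in>I. \<exists>y\<in>G'. mdist X (x i) y < r / (2 * L)}. w i) \<le> (1 - 1 / real (N ^ j)) * (\<Sum>i\<in>I. w i)"
proof -
  have L: "L \<ge> 1" using alc by (simp add: annularly_linearly_connected_def)
  have "x ` I \<subseteq> mspace X" "r / (2 * L) > 0" using I r L by auto
  then obtain Z where Z: "Z \<subseteq> x ` I"
    "\<And>z w. z \<in> Z \<Longrightarrow> w \<in> Z \<Longrightarrow> z \<noteq> w \<Longrightarrow> r / (2 * L) \<le> mdist X z w"
    "\<And>y. y \<in> x ` I \<Longrightarrow> \<exists>z\<in>Z. mdist X z y < r / (2 * L)"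
    using maximal_separated_subset[of "x ` I" X "r / (2 * L)"] I(1) by blast
  have ZX: "Z \<subseteq> mspace X" "finite Z" using Z(1) I(1,2) finite_subset[OF Z(1)] by auto
  have deg: "card {u \<in> Z. u \<noteq> v \<and> mdist X u v < 4 * L * r} < N ^ j" if v: "v \<in> Z" for v
  proof -
    let ?S = "{u \<in> Z. mdist X u v < 4 * L * r}"
    have "L * L * 16 \<le> 2 ^ j" using j by (simp add: power2_eq_square)
    then have "r * (L * L * 16) \<le> r * 2 ^ j" using r by simp
    then have fine: "2 * (4 * L * r) / 2 ^ j \<le> r / (2 * L)"
      using L by (simp add: field_simps)
    have vX: "v \<in> mspace X" using v ZX by auto
    have "card ?S \<le> N ^ j"
    proof (rule doubling_card_separated[OF dbl vX _ _ _ fine])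
      show "0 < 4 * L * r" using r L by simp
      show "?S \<subseteq> mball_of X v (4 * L * r)" using ZX vX by (auto simp: mdist_commute)
    qed (use Z(2) in auto)
    moreover have "{u \<in> Z. u \<noteq> v \<and> mdist X u v < 4 * L * r} = ?S - {v}" by blast
    moreover have "0 < 4 * L * r" using r L by simp
    then have "v \<in> ?S" using v vX by simp
    moreover have "finite ?S" using ZX by simp
    ultimately show ?thesis using card_Diff1_less[of ?S v] by simp
  qed
  have sym: "symp (\<lambda>u v. mdist X u v < 4 * L * r)" by (auto simp: symp_def mdist_commute)
  have deg': "\<forall>v\<in>Z. card {u \<in> Z. u \<noteq> v \<and> mdist X u v < 4 * L * r} < N ^ j"
    using deg by (rule ballI)
  obtain c where c: "\<forall>v\<in>Z. c v < N ^ j"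
    "\<forall>u\<in>Z. \<forall>v\<in>Z. u \<noteq> v \<longrightarrow> mdist X u v < 4 * L * r \<longrightarrow> c u \<noteq> c v"
    using greedy_colouring[OF ZX(2) sym deg'] by (elim exE conjE)
  have aX: "a \<in> mspace X" using ab con connectedin_mspace by blast
  have "N > 0" using dbl aX by (rule doubling_constant_pos)
  have killed: "\<forall>i\<in>I. \<exists>m<N ^ j. \<exists>z\<in>Z. c z = m \<and> mdist X z (x i) < r / (2 * L)"
  proof
    fix i assume "i \<in> I"
    then obtain z where "z \<in> Z" "mdist X z (x i) < r / (2 * L)" using Z(3) by blast
    then show "\<exists>m<N ^ j. \<exists>z\<in>Z. c z = m \<and> mdist X z (x i) < r / (2 * L)" using c(1) by blast
  qed
  have "N ^ j > 0" using \<open>N > 0\<close> by simp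
  then obtain m where m: "(\<Sum>i\<in>{i\<in>I. \<not> (\<exists>z\<in>Z. c z = m \<and> mdist X z (x i) < r / (2 * L))}. w i)
      \<le> (1 - 1 / real (N ^ j)) * (\<Sum>i\<in>I. w i)"
    using good_colour[OF I(1,3) \<open>N ^ j > 0\<close> killed] by (elim exE conjE)
  have fm: "finite {z \<in> Z. c z = m}" and sm: "{z \<in> Z. c z = m} \<subseteq> mspace X" using ZX by auto
  have far: "\<forall>z\<in>{z \<in> Z. c z = m}. \<forall>w\<in>{z \<in> Z. c z = m}. z \<noteq> w \<longrightarrow> 4 * L * r \<le> mdist X z w"
  proof (intro ballI impI)
    fix z w assume zw: "z \<in> {z \<in> Z. c z = m}" "w \<in> {z \<in> Z. c z = m}" "z \<noteq> w"
    have "c z \<noteq> c w" if "mdist X z w < 4 * L * r"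
      using c(2)[rule_format, of z w] zw that by simp
    moreover have "c z = c w" using zw by simp
    ultimately show "4 * L * r \<le> mdist X z w" by (meson not_less)
  qed
  obtain G' where G': "connectedin (mtopology_of X) G'"
    "\<And>z. z \<in> {z \<in> Z. c z = m} \<Longrightarrow> G' \<inter> mball_of X z (r / L) = {}"
    "\<And>y. y \<in> G' \<Longrightarrow> \<exists>u\<in>G. mdist X u y \<le> (2 * L + 2) * r"
    "\<And>u. u \<in> G \<Longrightarrow> \<exists>y\<in>G'. mdist X u y \<le> 3 * r"
    using detour[OF alc con r fm sm far ab] by blast
  have "{i\<in>I. \<exists>y\<in>G'. mdist X (x i) y < r / (2 * L)} \<subseteq>
      {i\<in>I. \<not> (\<exists>z\<in>Z. c z = m \<and> mdist X z (x i) < r / (2 * L))}"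
  proof clarify
    fix i y z assume i: "i \<in> I" and y: "y \<in> G'" "mdist X (x i) y < r / (2 * L)"
      and z: "z \<in> Z" "mdist X z (x i) < r / (2 * L)" "m = c z"
    have yX: "y \<in> mspace X" using y G'(1) connectedin_mspace by blast
    have zX: "z \<in> mspace X" using z ZX by auto
    have "mdist X z y \<le> mdist X z (x i) + mdist X (x i) y"
      using yX zX I(2)[rule_format, OF i] by (intro mdist_triangle)
    also have "\<dots> < r / (2 * L) + r / (2 * L)" using y z by simp
    also have "\<dots> = r / L" by (simp add: field_simps)
    finally have "y \<in> G' \<inter> mball_of X z (r / L)" using yX zX y by simp
    then show False using G'(2)[of z] z by auto
  qed
  then have "(\<Sum>i\<in>{i\<in>I. \<exists>y\<in>G'. mdist X (x i) y < r / (2 * L)}. w i) \<le>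
      (\<Sum>i\<in>{i\<in>I. \<not> (\<exists>z\<in>Z. c z = m \<and> mdist X z (x i) < r / (2 * L))}. w i)"
    using I by (intro sum_mono2) auto
  with m have "(\<Sum>i\<in>{i\<in>I. \<exists>y\<in>G'. mdist X (x i) y < r / (2 * L)}. w i)
      \<le> (1 - 1 / real (N ^ j)) * (\<Sum>i\<in>I. w i)" by linarith
  with G' show ?thesis by blast
qed

text \<open>Iterating over scales \<open>s\<close>, \<open>s / 2\<^sup>j\<close>, \<open>s / 4\<^sup>j\<close>, \<open>\<dots>\<close> gains a factor \<open>q\<close> of the weight of the surviving
  balls each time. A ball of radius \<open>s / 2\<^bsup>j k\<^esup>\<close> takes part in the first \<open>k\<close> steps and no longer matters
  afterwards. It is dropped as soon as the current set has distance at least \<open>8 L\<close> times the current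
  scale from its centre. This is safe since all later steps together move the set by at most \<open>6 L\<close>
  times the current scale. As \<open>2\<^sup>j \<ge> 16 L\<^sup>2\<close>, the radius \<open>8 L s / 2\<^sup>j\<close> used at the next scale is at most
  the radius \<open>s / (2 L)\<close> that is avoided at the present one. The set loses diameter at most \<open>6 s\<close> in
  the first step, hence less than \<open>8 s\<close> in total.\<close>

lemma multiscale_avoidance:
  fixes w :: "'i \<Rightarrow> real" and k :: "'i \<Rightarrow> nat"
  assumes alc: "annularly_linearly_connected L X" and dbl: "doubling N X" and j: "16 * L\<^sup>2 \<le> 2 ^ j"
    and I: "finite I" "\<And>i. i \<in> I \<Longrightarrow> x i \<in> mspace X" "\<And>i. i \<in> I \<Longrightarrow> 0 \<le> w i"
    and con: "connectedin (mtopology_of X) G" and s: "s > 0" and e: "e \<ge> 0"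
    and ab: "a \<in> G" "b \<in> G" "e + 8 * s \<le> mdist X a b"
  shows "\<exists>G' a' b'. connectedin (mtopology_of X) G' \<and>
    (\<forall>y\<in>G'. \<exists>u\<in>G. mdist X u y \<le> 6 * L * s) \<and> a' \<in> G' \<and> b' \<in> G' \<and> e \<le> mdist X a' b' \<and>
    (\<Sum>i\<in>{i\<in>I. \<exists>y\<in>G'. mdist X (x i) y \<le> s / (2 ^ j) ^ k i}. w i)
      \<le> (\<Sum>i\<in>{i\<in>I. \<exists>y\<in>G. mdist X (x i) y < 8 * L * s}. w i * (1 - 1 / real (N ^ j)) ^ k i)"
proof -
  have L: "L \<ge> 1" using alc by (simp add: annularly_linearly_connected_def)
  define q where "q = 1 - 1 / real (N ^ j)"
  have q: "q \<ge> 0"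
  proof -
    have "a \<in> mspace X" using ab con connectedin_mspace by blast
    then have "N > 0" using doubling_constant_pos[OF dbl] by simp
    then have "1 \<le> real N ^ j" by (intro one_le_power) simp
    then show ?thesis by (simp add: q_def divide_le_eq)
  qed
  have J: "16 * (L * L) \<le> 2 ^ j" using j by (simp add: power2_eq_square)
  have J16: "(16::real) \<le> 2 ^ j" using J L mult_mono[of 1 L 1 L] by linarith
  have tri: "mdist X x z \<le> mdist X x y + mdist X y z"
    if "x \<in> mspace X" "y \<in> mspace X" "z \<in> mspace X" for x y z
    using that by (rule mdist_triangle)
  have main: "\<exists>G' a' b'. connectedin (mtopology_of X) G' \<and>
    (\<forall>y\<in>G'. \<exists>u\<in>G. mdist X u y \<le> 6 * L * s) \<and> a' \<in> G' \<and> b' \<in> G' \<and> e \<le> mdist X a' b' \<and>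
    (\<Sum>i\<in>{i\<in>I. \<exists>y\<in>G'. mdist X (x i) y \<le> s / (2 ^ j) ^ k i}. w i)
      \<le> (\<Sum>i\<in>{i\<in>I. \<exists>y\<in>G. mdist X (x i) y < 8 * L * s}. w i * q ^ k i)"
    if "\<And>i. i \<in> I \<Longrightarrow> k i \<le> n" "finite I" "\<And>i. i \<in> I \<Longrightarrow> x i \<in> mspace X" "\<And>i. i \<in> I \<Longrightarrow> 0 \<le> w i"
      "connectedin (mtopology_of X) G" "s > 0" "a \<in> G" "b \<in> G" "e + 8 * s \<le> mdist X a b"
    for n :: nat and I and k :: "'i \<Rightarrow> nat" and G s a b
    using that
  proof (induction n arbitrary: I k G s a b)
    case (0 I k G s a b)
    have sub: "{i\<in>I. \<exists>y\<in>G. mdist X (x i) y \<le> s / (2 ^ j) ^ k i} \<subseteq> {i\<in>I. \<exists>y\<in>G. mdist X (x i) y < 8 * L * s}"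
    proof clarify
      fix i y assume i: "i \<in> I" "y \<in> G" "mdist X (x i) y \<le> s / (2 ^ j) ^ k i"
      have "s < 8 * L * s" using L \<open>s > 0\<close> by simp
      then show "\<exists>y\<in>G. mdist X (x i) y < 8 * L * s" using i 0(1)[of i] by (intro bexI[of _ y]) auto
    qed
    have "(\<Sum>i\<in>{i\<in>I. \<exists>y\<in>G. mdist X (x i) y \<le> s / (2 ^ j) ^ k i}. w i)
        \<le> (\<Sum>i\<in>{i\<in>I. \<exists>y\<in>G. mdist X (x i) y < 8 * L * s}. w i)"
      using 0 sub by (intro sum_mono2) auto
    also have "\<dots> = (\<Sum>i\<in>{i\<in>I. \<exists>y\<in>G. mdist X (x i) y < 8 * L * s}. w i * q ^ k i)"
      using 0(1) by (intro sum.cong) auto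
    finally have "(\<Sum>i\<in>{i\<in>I. \<exists>y\<in>G. mdist X (x i) y \<le> s / (2 ^ j) ^ k i}. w i) \<le> \<dots>" .
    moreover have "\<forall>y\<in>G. \<exists>u\<in>G. mdist X u y \<le> 6 * L * s"
    proof
      fix y assume "y \<in> G"
      moreover have "mdist X y y = 0" using \<open>y \<in> G\<close> connectedin_mspace 0(5) by force
      ultimately show "\<exists>u\<in>G. mdist X u y \<le> 6 * L * s" using L \<open>s > 0\<close> by (intro bexI[of _ y]) auto
    qed
    ultimately show ?case using 0 by (intro exI[of _ G] exI[of _ a] exI[of _ b]) auto
  next
    case (Suc n I k G s a b)
    note fin = Suc.prems(2) and xX = Suc.prems(3) and w = Suc.prems(4) and con = Suc.prems(5)
      and s = Suc.prems(6)
    have GX: "G \<subseteq> mspace X" using con by (rule connectedin_mspace)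
    define t where "t = s / 2 ^ j"
    have t: "t > 0" "16 * t \<le> s" "8 * L * t \<le> s / (2 * L)" "s + (6 * L * t + (2 * L + 2) * s) < 8 * L * s"
      "6 * L * t + (2 * L + 2) * s \<le> 6 * L * s" "8 * L * t + (2 * L + 2) * s \<le> 8 * L * s"
    proof -
      show "t > 0" using s by (simp add: t_def)
      show t16: "16 * t \<le> s" using s J16 by (simp add: t_def divide_le_eq mult.commute)
      have "s * (16 * (L * L)) \<le> s * 2 ^ j" using s J by simp
      then show "8 * L * t \<le> s / (2 * L)" using L by (simp add: t_def field_simps)
      have "L * (16 * t) \<le> L * s" using t16 L by simp
      then have "16 * (L * t) \<le> L * s" by simp
      moreover have "1 * s \<le> L * s" using L s by (intro mult_right_mono) auto
      ultimately show "s + (6 * L * t + (2 * L + 2) * s) < 8 * L * s"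
        "6 * L * t + (2 * L + 2) * s \<le> 6 * L * s" "8 * L * t + (2 * L + 2) * s \<le> 8 * L * s"
        using s by (simp_all only: distrib_right mult.assoc)
    qed
    define near where "near i \<longleftrightarrow> (\<exists>y\<in>G. mdist X (x i) y < 8 * L * s)" for i
    define I0 where "I0 = {i\<in>I. k i = 0}"
    define I1 where "I1 = {i\<in>I. k i \<noteq> 0}"
    define v where "v i = w i * q ^ (k i - 1)" for i
    have v: "0 \<le> v i" if "i \<in> I" for i using w[OF that] q by (simp add: v_def)
    have finI: "finite {i\<in>I1. near i}" "\<forall>i\<in>{i\<in>I1. near i}. x i \<in> mspace X"
      "\<forall>i\<in>{i\<in>I1. near i}. 0 \<le> v i"
      using fin xX v by (auto simp: I1_def)
    have ab2: "2 * s \<le> mdist X a b" using Suc.prems e s by linarith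
    obtain G1 where G1: "connectedin (mtopology_of X) G1"
      "\<And>y. y \<in> G1 \<Longrightarrow> \<exists>u\<in>G. mdist X u y \<le> (2 * L + 2) * s"
      "\<And>u. u \<in> G \<Longrightarrow> \<exists>y\<in>G1. mdist X u y \<le> 3 * s"
      "(\<Sum>i\<in>{i\<in>{i\<in>I1. near i}. \<exists>y\<in>G1. mdist X (x i) y < s / (2 * L)}. v i) \<le> q * (\<Sum>i\<in>{i\<in>I1. near i}. v i)"
      using one_scale_avoidance[OF alc dbl j con s Suc.prems(7,8) ab2 finI] unfolding q_def by blast
    have G1X: "G1 \<subseteq> mspace X" using G1(1) by (rule connectedin_mspace)
    obtain a1 b1 where ab1: "a1 \<in> G1" "b1 \<in> G1" "mdist X a a1 \<le> 3 * s" "mdist X b b1 \<le> 3 * s"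
      using G1(3) Suc.prems(7,8) by meson
    have "mdist X a b \<le> mdist X a a1 + mdist X a1 b1 + mdist X b b1"
      using tri[of a a1 b] tri[of a1 b1 b] Suc.prems(7,8) GX G1X ab1 mdist_commute[of X b b1]
      by (simp add: subset_iff)
    then have ab1d: "e + 8 * t \<le> mdist X a1 b1" using ab1 Suc.prems(9) t by linarith
    have "\<exists>G' a' b'. connectedin (mtopology_of X) G' \<and>
      (\<forall>y\<in>G'. \<exists>u\<in>G1. mdist X u y \<le> 6 * L * t) \<and> a' \<in> G' \<and> b' \<in> G' \<and> e \<le> mdist X a' b' \<and>
      (\<Sum>i\<in>{i\<in>I1. \<exists>y\<in>G'. mdist X (x i) y \<le> t / (2 ^ j) ^ (k i - 1)}. w i)
      \<le> (\<Sum>i\<in>{i\<in>I1. \<exists>y\<in>G1. mdist X (x i) y < 8 * L * t}. w i * q ^ (k i - 1))"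
      using Suc.IH[of I1 "\<lambda>i. k i - 1" G1 t a1 b1] Suc.prems t(1) G1(1) ab1(1,2) ab1d
      by (force simp: I1_def)
    then obtain G' a' b' where G': "connectedin (mtopology_of X) G'"
      "\<And>y. y \<in> G' \<Longrightarrow> \<exists>u\<in>G1. mdist X u y \<le> 6 * L * t" "a' \<in> G'" "b' \<in> G'" "e \<le> mdist X a' b'"
      "(\<Sum>i\<in>{i\<in>I1. \<exists>y\<in>G'. mdist X (x i) y \<le> t / (2 ^ j) ^ (k i - 1)}. w i)
      \<le> (\<Sum>i\<in>{i\<in>I1. \<exists>y\<in>G1. mdist X (x i) y < 8 * L * t}. v i)"
      unfolding v_def by blast
    have G'X: "G' \<subseteq> mspace X" using G'(1) by (rule connectedin_mspace)
    have close: "\<exists>u\<in>G. mdist X u y \<le> 6 * L * t + (2 * L + 2) * s" if y: "y \<in> G'" for y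
    proof -
      obtain u1 where u1: "u1 \<in> G1" "mdist X u1 y \<le> 6 * L * t" using G'(2) y by blast
      obtain u where u: "u \<in> G" "mdist X u u1 \<le> (2 * L + 2) * s" using G1(2) u1 by blast
      have "mdist X u y \<le> mdist X u u1 + mdist X u1 y"
        using u u1 y GX G1X G'X by (intro tri) auto
      then show ?thesis using u u1 by force
    qed
    have nearI: "near i" if i: "i \<in> I" and y: "y \<in> mspace X" "mdist X (x i) y \<le> c" and
      u: "u \<in> G" "mdist X u y \<le> c'" and c: "c + c' < 8 * L * s" for i y u c c'
    proof -
      have "mdist X (x i) u \<le> mdist X (x i) y + mdist X u y"
        using tri[of "x i" y u] i xX y u GX by (auto simp: mdist_commute)
      then show ?thesis using y u c unfolding near_def by (intro bexI[of _ u]) auto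
    qed
    have I0: "{i\<in>I0. \<exists>y\<in>G'. mdist X (x i) y \<le> s / (2 ^ j) ^ k i} \<subseteq> {i\<in>I0. near i}"
    proof clarify
      fix i y assume i: "i \<in> I0" "y \<in> G'" "mdist X (x i) y \<le> s / (2 ^ j) ^ k i"
      then have "mdist X (x i) y \<le> s" "i \<in> I" by (auto simp: I0_def)
      moreover obtain u where "u \<in> G" "mdist X u y \<le> 6 * L * t + (2 * L + 2) * s" using close i by blast
      moreover have "y \<in> mspace X" using i G'X by blast
      ultimately show "near i" using nearI t(4) by blast
    qed
    have I1: "{i\<in>I1. \<exists>y\<in>G1. mdist X (x i) y < 8 * L * t} \<subseteq> {i\<in>{i\<in>I1. near i}. \<exists>y\<in>G1. mdist X (x i) y < s / (2 * L)}"
    proof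
      fix i assume "i \<in> {i\<in>I1. \<exists>y\<in>G1. mdist X (x i) y < 8 * L * t}"
      then obtain y where i: "i \<in> I1" "y \<in> G1" "mdist X (x i) y < 8 * L * t" by blast
      obtain u where u: "u \<in> G" "mdist X u y \<le> (2 * L + 2) * s" using G1(2) i by blast
      have "near i"
        using nearI[of i y "mdist X (x i) y" u "(2 * L + 2) * s"] i u G1X t(6) by (auto simp: I1_def)
      moreover have "mdist X (x i) y < s / (2 * L)" using i t(3) by linarith
      ultimately show "i \<in> {i\<in>{i\<in>I1. near i}. \<exists>y\<in>G1. mdist X (x i) y < s / (2 * L)}" using i by blast
    qed
    have split: "(\<Sum>i\<in>{i\<in>I. P i}. f i) = (\<Sum>i\<in>{i\<in>I0. P i}. f i) + (\<Sum>i\<in>{i\<in>I1. P i}. f i)"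
      for P and f :: "'i \<Rightarrow> real"
    proof -
      have "{i\<in>I. P i} = {i\<in>I0. P i} \<union> {i\<in>I1. P i}" by (auto simp: I0_def I1_def)
      moreover have "(\<Sum>i\<in>{i\<in>I0. P i} \<union> {i\<in>I1. P i}. f i) = (\<Sum>i\<in>{i\<in>I0. P i}. f i) + (\<Sum>i\<in>{i\<in>I1. P i}. f i)"
        using fin by (intro sum.union_disjoint) (auto simp: I0_def I1_def)
      ultimately show ?thesis by simp
    qed
    have "(\<Sum>i\<in>{i\<in>I0. \<exists>y\<in>G'. mdist X (x i) y \<le> s / (2 ^ j) ^ k i}. w i) \<le> (\<Sum>i\<in>{i\<in>I0. near i}. w i)"
      using I0 fin w by (intro sum_mono2) (auto simp: I0_def)
    also have "\<dots> = (\<Sum>i\<in>{i\<in>I0. near i}. w i * q ^ k i)" by (intro sum.cong) (auto simp: I0_def)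
    finally have s0: "(\<Sum>i\<in>{i\<in>I0. \<exists>y\<in>G'. mdist X (x i) y \<le> s / (2 ^ j) ^ k i}. w i) \<le> \<dots>" .
    have "s / (2 ^ j) ^ k i = t / (2 ^ j) ^ (k i - 1)" if "i \<in> I1" for i
      using that by (cases "k i") (auto simp: I1_def t_def)
    then have "(\<Sum>i\<in>{i\<in>I1. \<exists>y\<in>G'. mdist X (x i) y \<le> s / (2 ^ j) ^ k i}. w i)
       = (\<Sum>i\<in>{i\<in>I1. \<exists>y\<in>G'. mdist X (x i) y \<le> t / (2 ^ j) ^ (k i - 1)}. w i)"
      by (intro sum.cong) auto
    also have "\<dots> \<le> (\<Sum>i\<in>{i\<in>I1. \<exists>y\<in>G1. mdist X (x i) y < 8 * L * t}. v i)" by (rule G'(6))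
    also have "\<dots> \<le> (\<Sum>i\<in>{i\<in>{i\<in>I1. near i}. \<exists>y\<in>G1. mdist X (x i) y < s / (2 * L)}. v i)"
      using I1 fin v by (intro sum_mono2) (auto simp: I1_def)
    also have "\<dots> \<le> q * (\<Sum>i\<in>{i\<in>I1. near i}. v i)" by (rule G1(4))
    also have "\<dots> = (\<Sum>i\<in>{i\<in>I1. near i}. w i * q ^ k i)"
      unfolding sum_distrib_left
    proof (rule sum.cong)
      fix i assume "i \<in> {i\<in>I1. near i}"
      then show "q * v i = w i * q ^ k i" by (cases "k i") (auto simp: I1_def v_def)
    qed simp
    finally have s1: "(\<Sum>i\<in>{i\<in>I1. \<exists>y\<in>G'. mdist X (x i) y \<le> s / (2 ^ j) ^ k i}. w i) \<le> \<dots>" .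
    have "(\<Sum>i\<in>{i\<in>I. \<exists>y\<in>G'. mdist X (x i) y \<le> s / (2 ^ j) ^ k i}. w i)
      \<le> (\<Sum>i\<in>{i\<in>I. near i}. w i * q ^ k i)"
      using s0 s1 unfolding split by linarith
    moreover have "\<forall>y\<in>G'. \<exists>u\<in>G. mdist X u y \<le> 6 * L * s"
      using close t(5) by (meson order_trans)
    ultimately show ?case
      using G' unfolding near_def by (intro exI[of _ G'] exI[of _ a'] exI[of _ b']) auto
  qed
  have "k i \<le> Max (k ` I)" if "i \<in> I" for i using that I by auto
  from main[OF this I con s ab] show ?thesis unfolding q_def .
qed

section \<open>Compactness, distortion and coverings\<close>

lemma compactin_mcball_of:
  assumes comp: "mcomplete_of X" and dbl: "doubling N X" and p: "p \<in> mspace X"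
  shows "compactin (mtopology_of X) (mcball_of X p R)"
proof -
  interpret Metric_space "mspace X" "mdist X" by simp
  have mt: "mtopology = mtopology_of X" and mb: "mball = mball_of X"
    by (simp_all add: mtopology_of_def mball_of_def)
  have mc: mcomplete using comp by (simp add: mcomplete_of_def)
  let ?S = "mcball_of X p R"
  have "mtotally_bounded ?S"
    unfolding mtotally_bounded_def
  proof (intro allI impI)
    fix e :: real assume e: "e > 0"
    define r where "r = max R 0 + 1"
    have r: "r > 0" "R < r" by (auto simp: r_def)
    obtain n where "2 * r / e < 2 ^ n" using real_arch_pow[of 2 "2 * r / e"] by auto
    then have n: "r / 2 ^ n \<le> e / 2" using e by (simp add: field_simps)
    obtain F where F: "F \<subseteq> mspace X" "finite F" "card F \<le> N ^ n"
      "mball_of X p r \<subseteq> (\<Union>y\<in>F. mball_of X y (r / 2 ^ n))"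
      using doubling_iterate[OF dbl p r(1), of n] by (elim exE conjE)
    define F' where "F' = {z \<in> F. ?S \<inter> mball_of X z (r / 2 ^ n) \<noteq> {}}"
    obtain h where h: "\<And>z. z \<in> F' \<Longrightarrow> h z \<in> ?S \<inter> mball_of X z (r / 2 ^ n)"
      using bchoice[of F' "\<lambda>z y. y \<in> ?S \<inter> mball_of X z (r / 2 ^ n)"] unfolding F'_def by blast
    have "?S \<subseteq> (\<Union>y\<in>h ` F'. mball y e)"
    proof
      fix x assume x: "x \<in> ?S"
      then have "x \<in> mball_of X p r" using r by auto
      then obtain z where z: "z \<in> F" "x \<in> mball_of X z (r / 2 ^ n)" using F(4) by blast
      then have zF': "z \<in> F'" using x by (auto simp: F'_def)
      have hz: "h z \<in> mspace X" "mdist X z (h z) < r / 2 ^ n" "z \<in> mspace X" using h[OF zF'] by auto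
      have "mdist X (h z) x \<le> mdist X (h z) z + mdist X z x"
        using hz z(2) by (intro mdist_triangle) auto
      moreover have "mdist X z x < r / 2 ^ n" using z(2) by simp
      then have "mdist X z x < e / 2" using n by linarith
      moreover have "mdist X (h z) z < e / 2"
        using hz(2) n unfolding mdist_commute[of X "h z" z] by linarith
      ultimately have "mdist X (h z) x < e" by linarith
      then have "x \<in> mball (h z) e" using hz x by (auto simp: mb)
      then show "x \<in> (\<Union>y\<in>h ` F'. mball y e)" using zF' by blast
    qed
    moreover have "finite (h ` F')" using F(2) by (simp add: F'_def)
    moreover have "h ` F' \<subseteq> ?S" using h by blast
    ultimately show "\<exists>K. finite K \<and> K \<subseteq> ?S \<and> ?S \<subseteq> (\<Union>x\<in>K. mball x e)" by blast
  qed
  then have "compactin mtopology (mtopology closure_of ?S)"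
    using mtotally_bounded_eq_compact_closure_of[OF mc] by blast
  moreover have "mtopology closure_of ?S = ?S"
    using closedin_mcball_of[of X p R] by (simp only: mt closure_of_eq)
  ultimately show ?thesis by (simp only: mt)
qed

text \<open>A homeomorphism of the half line fixes \<open>0\<close> and is continuous there.\<close>

lemma homeomorphism_nonneg_small:
  assumes hom: "homeomorphism {0..} {0..} \<eta> \<theta>" and e: "e > (0::real)"
  obtains t :: real where "t > 0" "\<eta> t \<le> e"
proof -
  have cont: "continuous_on {0..} \<eta>" and inv: "\<And>x. x \<in> {0..} \<Longrightarrow> \<theta> (\<eta> x) = x" and
    sur: "\<And>y. y \<in> {0..} \<Longrightarrow> \<eta> (\<theta> y) = y" "\<eta> ` {0..} = {0..}" "\<theta> ` {0..} = {0..}"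
    using hom by (auto simp: homeomorphism_def)
  have nonneg: "\<eta> x \<ge> 0" if "x \<ge> 0" for x using sur(2) that by auto
  have inj: "x = y" if "\<eta> x = \<eta> y" "x \<ge> 0" "y \<ge> 0" for x y using inv that by (metis atLeast_iff)
  define z where "z = \<theta> 0"
  have z: "z \<ge> 0" "\<eta> z = 0" using sur by (auto simp: z_def)
  have "z = 0"
  proof (rule ccontr)
    \<comment> \<open>otherwise a small positive value is attained on both sides of \<open>z\<close>\<close>
    assume "z \<noteq> 0"
    with z have z0: "z > 0" by simp
    define v where "v = min (\<eta> 0) (\<eta> (z + 1))"
    have "\<eta> 0 \<noteq> 0" "\<eta> (z + 1) \<noteq> 0" using inj[of 0 z] inj[of "z + 1" z] z z0 by auto
    then have v: "v > 0" "v \<le> \<eta> 0" "v \<le> \<eta> (z + 1)"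
      using nonneg[of 0] nonneg[of "z + 1"] z by (auto simp: v_def)
    obtain s where s: "0 \<le> s" "s \<le> z" "\<eta> s = v"
      using IVT2'[of \<eta> z v 0] v z continuous_on_subset[OF cont, of "{0..z}"] by auto
    obtain t where t: "z \<le> t" "t \<le> z + 1" "\<eta> t = v"
      using IVT'[of \<eta> z v "z + 1"] v z continuous_on_subset[OF cont, of "{z..z + 1}"] by auto
    have "s = t" using inj[of s t] s t z by simp
    then have "s = z" using s t by simp
    then show False using s z v by simp
  qed
  then have "\<eta> 0 = 0" using z by simp
  then obtain d where d: "d > 0" "\<And>x. x \<ge> 0 \<Longrightarrow> dist x 0 < d \<Longrightarrow> dist (\<eta> x) 0 < e"
    using cont e unfolding continuous_on_iff by (metis atLeast_iff order_refl)
  show thesis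
  proof (rule that[of "d / 2"])
    show "\<eta> (d / 2) \<le> e" using d(2)[of "d / 2"] d(1) by simp
  qed (use d in simp)
qed

text \<open>The distance from \<open>a\<close> maps \<open>S\<close> onto a set that contains an interval of length \<open>d(a, b)\<close>, and maps
  the balls into intervals of twice their radius. Compare Lebesgue measures.\<close>

lemma connected_dist_le_cover:
  assumes con: "connectedin (mtopology_of Y) S" and J: "finite J" "\<forall>i\<in>J. y i \<in> mspace Y" "\<forall>i\<in>J. 0 \<le> r i"
    and cov: "S \<subseteq> (\<Union>i\<in>J. mball_of Y (y i) (r i))" and ab: "a \<in> S" "b \<in> S"
  shows "mdist Y a b \<le> (\<Sum>i\<in>J. 2 * r i)"
proof -
  have SY: "S \<subseteq> mspace Y" using con by (rule connectedin_mspace)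
  define g where "g = mdist Y a"
  have aY: "a \<in> mspace Y" using ab SY by blast
  have "connected (g ` S)" unfolding g_def using con aY by (rule connected_mdist_image)
  moreover have "0 \<in> g ` S" "g b \<in> g ` S" using ab aY by (force simp: g_def)+
  ultimately have "{0..g b} \<subseteq> g ` S" by (rule connected_contains_Icc)
  also have "\<dots> \<subseteq> (\<Union>i\<in>J. {g (y i) - r i..g (y i) + r i})"
  proof clarify
    fix s assume s: "s \<in> S"
    then obtain i where i: "i \<in> J" "s \<in> mball_of Y (y i) (r i)" using cov by blast
    have "g s \<le> g (y i) + mdist Y (y i) s" "g (y i) \<le> g s + mdist Y s (y i)"
      unfolding g_def using i s SY aY by (auto intro: mdist_triangle)
    then show "g s \<in> (\<Union>i\<in>J. {g (y i) - r i..g (y i) + r i})"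
      using i mdist_commute[of Y s "y i"] by (intro UN_I[of i]) auto
  qed
  finally have "emeasure lborel {0..g b} \<le> emeasure lborel (\<Union>i\<in>J. {g (y i) - r i..g (y i) + r i})"
    using J by (intro emeasure_mono) auto
  also have "\<dots> \<le> (\<Sum>i\<in>J. emeasure lborel {g (y i) - r i..g (y i) + r i})"
    using J by (intro emeasure_subadditive_finite) auto
  also have "\<dots> = (\<Sum>i\<in>J. ennreal (2 * r i))"
    using J by (intro sum.cong) auto
  also have "\<dots> = ennreal (\<Sum>i\<in>J. 2 * r i)" using J by (intro sum_ennreal) auto
  finally have "ennreal (g b) \<le> ennreal (\<Sum>i\<in>J. 2 * r i)" by (simp add: g_def)
  then show ?thesis using J by (simp add: g_def sum_nonneg ennreal_le_iff)
qed

text \<open>Balls are considered in order of decreasing radius, and a ball is selected if its centre lies in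
  no ball selected before. Asking for separated centres instead of disjoint balls lowers the enlargement
  factor to \<open>2\<close>.\<close>

lemma finite_vitali:
  assumes "finite I" "\<forall>i\<in>I. y i \<in> mspace Y" "\<forall>i\<in>I. 0 \<le> r i"
  shows "\<exists>J\<subseteq>I. (\<forall>i\<in>J. \<forall>j\<in>J. i \<noteq> j \<longrightarrow> r i \<le> mdist Y (y i) (y j)) \<and>
    (\<Union>i\<in>I. mball_of Y (y i) (r i)) \<subseteq> (\<Union>j\<in>J. mball_of Y (y j) (2 * r j))"
  using assms
proof (induction I rule: finite_ranking_induct[where f = "\<lambda>i. - r i"])
  case empty
  then show ?case by auto
next
  case (insert i I)
  then obtain J where J: "J \<subseteq> I" "\<forall>i\<in>J. \<forall>j\<in>J. i \<noteq> j \<longrightarrow> r i \<le> mdist Y (y i) (y j)"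
    "(\<Union>i\<in>I. mball_of Y (y i) (r i)) \<subseteq> (\<Union>j\<in>J. mball_of Y (y j) (2 * r j))" by auto
  have le: "r i \<le> r j" if "j \<in> I" for j using insert.hyps(2)[OF that] by simp
  have yi: "y i \<in> mspace Y" "0 \<le> r i" using insert.prems by auto
  show ?case
  proof (cases "\<exists>j\<in>J. mdist Y (y j) (y i) < r j")
    case True
    then obtain j where j: "j \<in> J" "mdist Y (y j) (y i) < r j" by blast
    have yj: "y j \<in> mspace Y" using j(1) J(1) insert.prems by blast
    have "mball_of Y (y i) (r i) \<subseteq> mball_of Y (y j) (2 * r j)"
    proof
      fix w assume w: "w \<in> mball_of Y (y i) (r i)"
      then have "mdist Y (y j) w \<le> mdist Y (y j) (y i) + mdist Y (y i) w"
        using yi yj by (intro mdist_triangle) auto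
      also have "\<dots> < r j + r j" using w j le[of j] J(1) by auto
      finally show "w \<in> mball_of Y (y j) (2 * r j)" using w yj by simp
    qed
    then have "(\<Union>i\<in>insert i I. mball_of Y (y i) (r i)) \<subseteq> (\<Union>j\<in>J. mball_of Y (y j) (2 * r j))"
      using J(3) j(1) by blast
    then show ?thesis using J(1,2) by blast
  next
    case False
    have "mball_of Y (y i) (r i) \<subseteq> mball_of Y (y i) (2 * r i)" using yi by auto
    then have "(\<Union>i\<in>insert i I. mball_of Y (y i) (r i)) \<subseteq> (\<Union>j\<in>insert i J. mball_of Y (y j) (2 * r j))"
      using J(3) by auto
    moreover have "\<forall>k\<in>insert i J. \<forall>j\<in>insert i J. k \<noteq> j \<longrightarrow> r k \<le> mdist Y (y k) (y j)"
    proof (intro ballI impI)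
      fix k j assume kj: "k \<in> insert i J" "j \<in> insert i J" "k \<noteq> j"
      have far: "r l \<le> mdist Y (y l) (y i)" if "l \<in> J" for l using False that by (meson not_less)
      consider "k = i" "j \<in> J" | "j = i" "k \<in> J" | "k \<in> J" "j \<in> J" using kj by blast
      then show "r k \<le> mdist Y (y k) (y j)"
      proof cases
        case 1
        then have "r i \<le> r j" using le J(1) by blast
        then show ?thesis using far[OF 1(2)] 1 mdist_commute[of Y "y i" "y j"] by simp
      qed (use far J(2) kj(3) in auto)
    qed
    moreover have "insert i J \<subseteq> insert i I" using J(1) by blast
    ultimately show ?thesis by blast
  qed
qed

section \<open>Coverings of spaces with vanishing Hausdorff measure\<close>

lemma powr_right_continuous_bound:
  assumes "D \<ge> (0::real)" "C > 0" "e > 0" "d > D"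
  obtains r where "D < r" "r \<le> d" "r powr C \<le> D powr C + e"
proof -
  have "((\<lambda>x. x powr C) \<longlongrightarrow> D powr C) (at_right D)"
  proof (rule tendsto_powr')
    show "D \<noteq> 0 \<or> 0 < C \<and> (\<forall>\<^sub>F x in at_right D. 0 \<le> x)"
      using assms by (auto simp: eventually_at_filter)
  qed auto
  then have "\<forall>\<^sub>F x in at_right D. x powr C < D powr C + e"
    using assms(3) by (intro order_tendstoD(2)) auto
  moreover have "\<forall>\<^sub>F x in at_right D. x \<in> {D<..<d}"
    using assms(4) by (rule eventually_at_right_real)
  ultimately have "\<forall>\<^sub>F x in at_right D. x powr C < D powr C + e \<and> x \<in> {D<..<d}"
    by (rule eventually_conj)
  then obtain r where "r powr C < D powr C + e \<and> r \<in> {D<..<d}"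
    using eventually_happens'[OF trivial_limit_at_right_real] by blast
  then show thesis by (intro that[of r]) auto
qed

lemma mdist_le_ediam:
  assumes "x \<in> U" "y \<in> U" "ediam X U \<le> ennreal \<delta>"
  shows "mdist X x y \<le> enn2real (ediam X U)"
proof -
  have "ennreal (mdist X x y) \<le> ediam X U"
    unfolding ediam_def using assms(1,2) by (meson SUP_upper2 order_refl)
  then have "enn2real (ennreal (mdist X x y)) \<le> enn2real (ediam X U)"
    using assms(3) by (intro enn2real_mono) (auto simp: order_le_less_trans)
  then show ?thesis by simp
qed

text \<open>The sets of a covering that nearly realises the vanishing Hausdorff measure are enlarged slightly
  to open balls, as they may have diameter \<open>0\<close>; compactness then leaves finitely many. Since all
  diameters are at most \<open>1\<close>, the exponent may be raised from \<open>s\<close> to \<open>C\<close>, which also takes care of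
  the convention for \<open>s = 0\<close>.\<close>

lemma small_ball_cover:
  assumes H: "hausdorff_measure Y s = 0" and s: "0 \<le> s" "s < C" and K: "compactin (mtopology_of Y) K"
    and e: "e > 0" and d: "d > 0"
  shows "\<exists>(I::nat set) y r. finite I \<and> (\<forall>i\<in>I. y i \<in> K \<and> 0 < r i \<and> r i \<le> d) \<and>
    K \<subseteq> (\<Union>i\<in>I. mball_of Y (y i) (r i)) \<and> (\<Sum>i\<in>I. r i powr C) < e"
proof -
  have KY: "K \<subseteq> mspace Y" using compactin_subset_topspace[OF K] by simp
  define \<delta> where "\<delta> = min (d / 2) 1"
  have \<delta>: "\<delta> > 0" "\<delta> \<le> 1" "\<delta> < d" using d by (auto simp: \<delta>_def)
  have "hausdorff_content Y s \<delta> \<le> hausdorff_measure Y s"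
    unfolding hausdorff_measure_def using \<delta> by (intro SUP_upper) auto
  then have "hausdorff_content Y s \<delta> < ennreal (e / 2)" using H e by simp
  then obtain U where U: "mspace Y \<subseteq> (\<Union>i. U i)" "\<forall>i. U i \<subseteq> mspace Y \<and> ediam Y (U i) \<le> ennreal \<delta>"
    "(\<Sum>i. diam_power Y s (U i)) < ennreal (e / 2)"
    unfolding hausdorff_content_def INF_less_iff by blast
  define D where "D i = enn2real (ediam Y (U i))" for i
  have D: "0 \<le> D i" "D i \<le> \<delta>" for i
    using U(2) \<delta> by (auto simp: D_def intro: enn2real_leI)
  have "\<exists>r. D i < r \<and> r \<le> d \<and> r powr C \<le> D i powr C + e / 2 * (1/2) ^ Suc i" for i
    by (rule powr_right_continuous_bound[of "D i" C "e / 2 * (1/2) ^ Suc i" d])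
       (use D[of i] s \<delta> e in auto)
  then obtain r where r: "\<And>i. D i < r i" "\<And>i. r i \<le> d"
    "\<And>i. r i powr C \<le> D i powr C + e / 2 * (1/2) ^ Suc i" by metis
  have DC: "ennreal (D i powr C) \<le> diam_power Y s (U i)" if "U i \<noteq> {}" for i
  proof (cases "s = 0")
    case True
    have "D i powr C \<le> 1" using D[of i] \<delta> s by (intro powr_le1) auto
    then show ?thesis using that True by (simp add: diam_power_def)
  next
    case False
    have "D i powr C \<le> D i powr s" using D[of i] \<delta> s by (intro powr_mono') auto
    then show ?thesis using that False by (simp add: diam_power_def D_def ennreal_leI)
  qed
  define I0 where "I0 = {i. U i \<inter> K \<noteq> {}}"
  have "\<forall>i\<in>I0. \<exists>y. y \<in> U i \<inter> K" by (auto simp: I0_def)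
  then obtain y where y: "\<And>i. i \<in> I0 \<Longrightarrow> y i \<in> U i \<inter> K" by (metis bchoice)
  have "K \<subseteq> (\<Union>i\<in>I0. mball_of Y (y i) (r i))"
  proof
    fix x assume x: "x \<in> K"
    then obtain i where i: "x \<in> U i" using U(1) KY by blast
    then have i0: "i \<in> I0" using x by (auto simp: I0_def)
    have "mdist Y (y i) x \<le> D i"
      unfolding D_def using y[OF i0] i U(2) by (intro mdist_le_ediam[of _ _ _ _ \<delta>]) auto
    then have "x \<in> mball_of Y (y i) (r i)" using r(1)[of i] y[OF i0] KY x by auto
    then show "x \<in> (\<Union>i\<in>I0. mball_of Y (y i) (r i))" using i0 by blast
  qed
  moreover have "\<forall>B\<in>(\<lambda>i. mball_of Y (y i) (r i)) ` I0. openin (mtopology_of Y) B"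
    by (auto intro: openin_mball_of)
  ultimately obtain \<F> where \<F>: "finite \<F>" "\<F> \<subseteq> (\<lambda>i. mball_of Y (y i) (r i)) ` I0" "K \<subseteq> \<Union>\<F>"
    using K unfolding compactin_def by meson
  obtain I where I: "I \<subseteq> I0" "finite I" "\<F> = (\<lambda>i. mball_of Y (y i) (r i)) ` I"
    using finite_subset_image[OF \<F>(1,2)] by blast
  have rpos: "0 < r i" for i using r(1)[of i] D(1)[of i] by linarith
  have "ennreal (\<Sum>i\<in>I. r i powr C) = (\<Sum>i\<in>I. ennreal (r i powr C))"
    by (rule sum_ennreal[symmetric]) simp
  also have "\<dots> \<le> (\<Sum>i\<in>I. diam_power Y s (U i) + ennreal (e / 2 * (1/2) ^ Suc i))"
  proof (rule sum_mono)
    fix i assume "i \<in> I"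
    then have ne: "U i \<noteq> {}" using I(1) by (auto simp: I0_def)
    have "ennreal (r i powr C) \<le> ennreal (D i powr C + e / 2 * (1/2) ^ Suc i)"
      using r(3) by (rule ennreal_leI)
    also have "\<dots> = ennreal (D i powr C) + ennreal (e / 2 * (1/2) ^ Suc i)"
      using e by (intro ennreal_plus) auto
    also have "\<dots> \<le> diam_power Y s (U i) + ennreal (e / 2 * (1/2) ^ Suc i)"
      using DC[OF ne] by (rule add_right_mono)
    finally show "ennreal (r i powr C) \<le> diam_power Y s (U i) + ennreal (e / 2 * (1/2) ^ Suc i)" .
  qed
  also have "\<dots> = (\<Sum>i\<in>I. diam_power Y s (U i)) + (\<Sum>i\<in>I. ennreal (e / 2 * (1/2) ^ Suc i))"
    by (rule sum.distrib)
  also have "\<dots> \<le> (\<Sum>i\<in>I. diam_power Y s (U i)) + ennreal (e / 2)"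
  proof (rule add_left_mono)
    have sm: "(\<lambda>i. e / 2 * (1/2) ^ Suc i) sums (e / 2 * 1)"
      by (intro sums_mult power_half_series)
    have "(\<Sum>i\<in>I. e / 2 * (1/2) ^ Suc i) \<le> suminf (\<lambda>i. e / 2 * (1/2) ^ Suc i)"
      using sm I(2) e by (intro sum_le_suminf) (auto simp: sums_iff)
    also have "\<dots> = e / 2" using sm by (simp add: sums_iff)
    finally have "ennreal (\<Sum>i\<in>I. e / 2 * (1/2) ^ Suc i) \<le> ennreal (e / 2)" by (rule ennreal_leI)
    moreover have "(\<Sum>i\<in>I. ennreal (e / 2 * (1/2) ^ Suc i)) = ennreal (\<Sum>i\<in>I. e / 2 * (1/2) ^ Suc i)"
      using e by (intro sum_ennreal) auto
    ultimately show "(\<Sum>i\<in>I. ennreal (e / 2 * (1/2) ^ Suc i)) \<le> ennreal (e / 2)" by (simp only:)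
  qed
  also have "\<dots> = ennreal (e / 2) + (\<Sum>i\<in>I. diam_power Y s (U i))" by (rule add.commute)
  also have "\<dots> \<le> ennreal (e / 2) + (\<Sum>i. diam_power Y s (U i))"
    using I(2) by (intro add_left_mono sum_le_suminf) auto
  also have "\<dots> < ennreal (e / 2) + ennreal (e / 2)"
    using U(3) by (simp add: ennreal_add_left_cancel_less)
  also have "\<dots> = ennreal e" using e by (simp flip: ennreal_plus)
  finally have "(\<Sum>i\<in>I. r i powr C) < e"
    using e by (subst (asm) ennreal_less_iff) (auto intro: sum_nonneg)
  moreover have "\<forall>i\<in>I. y i \<in> K \<and> 0 < r i \<and> r i \<le> d" using y I(1) rpos r(2) by blast
  moreover have "K \<subseteq> (\<Union>i\<in>I. mball_of Y (y i) (r i))" using \<F>(3) I(3) by simp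
  ultimately show ?thesis using I(2) by blast
qed

section \<open>The lower bound for quasi-symmetric images\<close>

text \<open>At most \<open>N\<^bsup>n + j m\<^esup>\<close> indices have \<open>k i = m\<close>, where \<open>n\<close> does not depend on \<open>m\<close>. The factor \<open>4\<close> in
  the base makes the sum over \<open>m\<close> a convergent geometric series.\<close>

lemma packing_sum:
  assumes dbl: "doubling N X" and p: "p \<in> mspace X" and R: "R > 0" and a: "a > 0"
  shows "\<exists>P\<ge>0. \<forall>(J::'i set) x k. finite J \<longrightarrow> (\<forall>i\<in>J. x i \<in> mball_of X p R) \<longrightarrow>
    (\<forall>i\<in>J. \<forall>l\<in>J. i \<noteq> l \<longrightarrow> a / (2 ^ j) ^ k i \<le> mdist X (x i) (x l)) \<longrightarrow>
    (\<Sum>i\<in>J. (1 / (4 * real (N ^ j))) ^ k i) \<le> P"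
proof -
  have N: "N > 0" using dbl p by (rule doubling_constant_pos)
  obtain n where "2 * R / a < 2 ^ n" using real_arch_pow[of 2 "2 * R / a"] by auto
  then have n: "2 * R / 2 ^ n \<le> a" using a by (simp add: field_simps)
  show ?thesis
  proof (intro exI[of _ "real (N ^ n) * 2"] conjI allI impI)
    fix J :: "'i set" and x k
    assume J: "finite J" "\<forall>i\<in>J. x i \<in> mball_of X p R"
      and sep: "\<forall>i\<in>J. \<forall>l\<in>J. i \<noteq> l \<longrightarrow> a / (2 ^ j) ^ k i \<le> mdist X (x i) (x l)"
    have per_scale: "(\<Sum>i\<in>{i\<in>J. k i = m}. (1 / (4 * real (N ^ j))) ^ k i) \<le> real (N ^ n) * (1 / 4) ^ m" for m
    proof -
      let ?J = "{i\<in>J. k i = m}"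
      have pos: "0 < a / (2 ^ j) ^ m" using a by simp
      have inj: "inj_on x ?J"
      proof (rule inj_onI, rule ccontr)
        fix i l assume il: "i \<in> ?J" "l \<in> ?J" "x i = x l" "i \<noteq> l"
        then have "a / (2 ^ j) ^ m \<le> mdist X (x i) (x l)" using sep by blast
        moreover have "x i \<in> mspace X" using J(2) il by auto
        then have "mdist X (x i) (x l) = 0" using il(3) by simp
        ultimately show False using pos by simp
      qed
      have "2 * R / 2 ^ (n + j * m) = 2 * R / 2 ^ n / (2 ^ j) ^ m" by (simp add: power_add power_mult)
      also have "\<dots> \<le> a / (2 ^ j) ^ m" using n by (intro divide_right_mono) auto
      finally have fine: "2 * R / 2 ^ (n + j * m) \<le> a / (2 ^ j) ^ m" .
      have "card (x ` ?J) \<le> N ^ (n + j * m)"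
      proof (rule doubling_card_separated(2)[OF dbl p R _ _ fine])
        show "x ` ?J \<subseteq> mball_of X p R" using J(2) by blast
        fix y z assume "y \<in> x ` ?J" "z \<in> x ` ?J" "y \<noteq> z"
        then obtain i l where "i \<in> J" "k i = m" "y = x i" "l \<in> J" "z = x l" "i \<noteq> l" by blast
        then show "a / (2 ^ j) ^ m \<le> mdist X y z" using sep by blast
      qed
      then have "card ?J \<le> N ^ (n + j * m)" by (simp add: card_image[OF inj])
      then have c: "real (card ?J) \<le> real (N ^ n) * real (N ^ j) ^ m"
        by (metis of_nat_le_iff of_nat_mult of_nat_power power_add power_mult)
      have "(\<Sum>i\<in>?J. (1 / (4 * real (N ^ j))) ^ k i) = real (card ?J) * (1 / (4 * real (N ^ j))) ^ m" by simp
      also have "\<dots> \<le> (real (N ^ n) * real (N ^ j) ^ m) * (1 / (4 * real (N ^ j))) ^ m"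
        using c by (intro mult_right_mono) auto
      also have "\<dots> = real (N ^ n) * (real (N ^ j) * (1 / (4 * real (N ^ j)))) ^ m"
        by (simp only: power_mult_distrib mult.assoc)
      also have "real (N ^ j) * (1 / (4 * real (N ^ j))) = 1 / 4" using N by simp
      finally show ?thesis .
    qed
    have "(\<Sum>i\<in>J. (1 / (4 * real (N ^ j))) ^ k i) = (\<Sum>m\<in>k ` J. \<Sum>i\<in>{i\<in>J. k i = m}. (1 / (4 * real (N ^ j))) ^ k i)"
      using J(1) by (rule sum.image_gen)
    also have "\<dots> \<le> (\<Sum>m\<in>k ` J. real (N ^ n) * (1 / 4) ^ m)"
      using per_scale by (rule sum_mono)
    also have "\<dots> = real (N ^ n) * (\<Sum>m\<in>k ` J. (1 / 4) ^ m)" by (rule sum_distrib_left[symmetric])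
    also have "(\<Sum>m\<in>k ` J. (1 / 4) ^ m) \<le> (\<Sum>m. (1 / 4 :: real) ^ m)"
      using J(1) by (intro sum_le_suminf summable_geometric) auto
    also have "(\<Sum>m. (1 / 4 :: real) ^ m) \<le> 2" by (subst suminf_geometric) auto
    finally show "(\<Sum>i\<in>J. (1 / (4 * real (N ^ j))) ^ k i) \<le> real (N ^ n) * 2"
      by (simp add: mult_left_mono)
  qed simp
qed

text \<open>The exponent \<open>al\<close> is chosen such that \<open>(b / q)\<^bsup>al\<^esup> = q\<close>. If \<open>r\<close> is at most \<open>l (b / q)\<^sup>k\<close>, the first
  term on the right dominates. Otherwise \<open>q\<^sup>k = ((b / q)\<^sup>k)\<^bsup>al\<^esup>\<close> is at most \<open>(r / l)\<^bsup>al\<^esup>\<close> and the second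
  one does.\<close>

lemma weight_dichotomy:
  fixes q b l r :: real
  assumes q: "0 < q" "q < 1" and b: "0 < b" "b < q" and l: "l > 0" and r: "r > 0"
    and al: "al = ln q / ln (b / q)"
  shows "r * q ^ k \<le> l * b ^ k + l powr (- al) * r powr (1 + al)"
proof -
  have lnq: "ln q < 0" "ln (b / q) < 0" using q b by (simp_all add: divide_less_eq)
  then have al0: "al > 0" by (simp add: al divide_neg_neg)
  define z where "z = (b / q) ^ k"
  have z: "z > 0" using q b by (simp add: z_def)
  have "(b / q) powr al = q" using q b lnq by (simp add: powr_def al)
  moreover have "z = (b / q) powr real k" using q b by (simp add: z_def powr_realpow)
  then have "z powr al = ((b / q) powr al) powr real k" by (simp add: powr_powr mult.commute)
  ultimately have zq: "z powr al = q ^ k" using q by (simp add: powr_realpow)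
  have bz: "b ^ k = z * q ^ k" using q by (simp add: z_def power_divide)
  show ?thesis
  proof (cases "r \<le> l * z")
    case True
    then have "r * q ^ k \<le> l * z * q ^ k" using q by (intro mult_right_mono) auto
    also have "\<dots> = l * b ^ k" by (simp add: bz)
    finally show ?thesis by (simp add: add_increasing2)
  next
    case False
    then have "z \<le> r / l" using l by (simp add: field_simps)
    then have "z powr al \<le> (r / l) powr al" using z al0 by (intro powr_mono2) auto
    then have "r * q ^ k \<le> r * (r / l) powr al" using r zq by simp
    also have "\<dots> = l powr (- al) * r powr (1 + al)"
      using r l by (simp add: powr_divide powr_add powr_minus field_simps)
    finally show ?thesis using l b by (simp add: add_increasing)
  qed
qed

lemma two_le_power:
  assumes "2 \<le> N" "j \<noteq> 0"
  shows "2 \<le> real (N ^ j)"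
proof -
  have "N ^ 1 \<le> N ^ j" using assms by (intro power_increasing) auto
  then have "2 \<le> N ^ j" using assms by simp
  then show ?thesis by linarith
qed

lemma reciprocal_bounds:
  fixes m :: real
  assumes "2 \<le> m"
  shows "1 / 2 \<le> 1 - 1 / m" "1 - 1 / m < 1" "0 < 1 / (4 * m)" "1 / (4 * m) \<le> 1 / 8"
  using assms by (simp_all add: field_simps)

text \<open>Cover the image of a compact ball \<open>K\<close> of \<open>X\<close> by balls \<open>B(y i, r i)\<close> of \<open>Y\<close> with small
  \<open>\<Sum> r i\<^bsup>1 + al\<^esup>\<close> and select a Vitali subfamily \<open>J\<close>. The depth \<open>k i\<close> is the last scale at which the
  preimage of \<open>B(y i, 2 r i)\<close> lies in the ball of radius \<open>s0 / 2\<^bsup>j (k i)\<^esup>\<close> around \<open>x i\<close>. By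
  quasi-symmetry, the separation of the \<open>y i\<close> implies that the \<open>x i\<close> are separated
  proportionally to these radii, so that \<open>\<Sum> b\<^bsup>k i\<^esup>\<close> is bounded. Now the connected set that avoids
  most of the weights \<open>r i\<close> has an image that is too short to be covered by the balls it meets.\<close>

lemma hausdorff_measure_quasi_symmetric_nonzero:
  assumes comp: "mcomplete_of X" and dbl: "doubling N X" and N: "N \<ge> 2"
    and alc: "annularly_linearly_connected L X" and j: "16 * L\<^sup>2 \<le> 2 ^ j"
    and two: "u \<in> mspace X" "v \<in> mspace X" "u \<noteq> v"
    and qs: "quasi_symmetric X Y"
    and q: "q = 1 - 1 / real (N ^ j)" and b: "b = 1 / (4 * real (N ^ j))"
    and al: "al = ln q / ln (b / q)" and s: "0 \<le> s" "s < 1 + al"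
  shows "hausdorff_measure Y s \<noteq> 0"
proof
  assume H: "hausdorff_measure Y s = 0"
  have L: "L \<ge> 1" using alc by (simp add: annularly_linearly_connected_def)
  have "1 * 1 \<le> L * L" using L by (intro mult_mono) auto
  then have "(16::real) \<le> 2 ^ j" using j by (simp add: power2_eq_square)
  then have "j \<noteq> 0" by (intro notI) simp
  with N have M: "2 \<le> real (N ^ j)" by (rule two_le_power)
  have qb: "1 / 2 \<le> q" "q < 1" "0 < b" "b \<le> 1 / 8"
    unfolding q b using reciprocal_bounds[OF M] by simp_all
  obtain f \<eta> \<theta> where hom: "homeomorphic_map (mtopology_of X) (mtopology_of Y) f"
    and eta: "homeomorphism {0..} {0..} \<eta> \<theta>"
    and qsf: "\<forall>x\<in>mspace X. \<forall>a\<in>mspace X. \<forall>b\<in>mspace X. \<forall>t\<ge>0.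
           mdist X x a \<le> t * mdist X x b \<longrightarrow>
           mdist Y (f x) (f a) \<le> \<eta> t * mdist Y (f x) (f b)"
    using qs unfolding quasi_symmetric_def quasi_symmetric_map_def by (elim exE conjE)
  have fcont: "continuous_map (mtopology_of X) (mtopology_of Y) f"
    using hom by (rule homeomorphic_imp_continuous_map)
  have finj: "inj_on f (mspace X)" using homeomorphic_imp_injective_map[OF hom] by simp
  have fY: "f x \<in> mspace Y" if "x \<in> mspace X" for x
    using fcont that by (auto simp: continuous_map_def)
  have eta_nonneg: "0 \<le> \<eta> t" if "0 \<le> t" for t
  proof -
    have "\<eta> ` {0..} = {0..}" using eta by (simp add: homeomorphism_def)
    then have "\<eta> t \<in> {0..}" using that by blast
    then show ?thesis by simp
  qed
  have conX: "connectedin (mtopology_of X) (mspace X)"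
    using alc connectedin_topspace[of "mtopology_of X"] by (simp add: annularly_linearly_connected_def)

  define D where "D = mdist X u v"
  have D: "D > 0" using two by (simp add: D_def order_less_le)
  have "mdist X u u \<le> D / 2" "D / 2 \<le> mdist X u v" using D two by (auto simp: D_def)
  then obtain a where a: "a \<in> mspace X" "mdist X u a = D / 2"
    using connected_point_at_distance[OF conX two(1) two(1,2)] by blast
  have "a \<in> annulus X u (D / 2) (2 * (D / 2))" "v \<in> annulus X u (D / 2) (2 * (D / 2))"
    using two a D by (auto simp: annulus_def D_def)
  then obtain G where G: "connectedin (mtopology_of X) G" "{a, v} \<subseteq> G"
    "G \<subseteq> annulus X u (D / 2 / L) (2 * L * (D / 2))"
    using annular_connected_hull[OF alc two(1), of "D / 2" "{a, v}"] D by auto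
  have GB: "mdist X u y \<le> L * D" if "y \<in> G" for y using G(3) that by (auto simp: annulus_def)
  have GX: "G \<subseteq> mspace X" using G(1) by (rule connectedin_mspace)
  \<comment> \<open>The arc from \<open>a\<close> to \<open>v\<close> spans at least \<open>D / 2\<close>. The rerouting costs \<open>8 * s0\<close>, half of this.\<close>
  define s0 where "s0 = D / 32"
  have s0: "s0 > 0" using D by (simp add: s0_def)
  have "mdist X u v \<le> mdist X u a + mdist X a v" using two a by (intro mdist_triangle)
  then have av: "D / 4 + 8 * s0 \<le> mdist X a v" using a by (simp add: D_def s0_def)
  define R where "R = L * D + 6 * L * s0"
  have R: "R > 0" using L D s0 by (simp add: R_def add_pos_pos)
  define K where "K = mcball_of X u R"
  have KX: "K \<subseteq> mspace X" by (auto simp: K_def)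
  have K: "compactin (mtopology_of Y) (f ` K)"
    unfolding K_def using compactin_mcball_of[OF comp dbl two(1)] fcont by (rule image_compactin)

  \<comment> \<open>Quasi-symmetry turns the distance between the two points \<open>f u\<close> and \<open>f v\<close> into a lower bound for the
    distances of all images of pairs that are \<open>s0\<close> apart.\<close>
  define t1 where "t1 = (R + D) / s0"
  have t1: "t1 > 0" using R D s0 by (simp add: t1_def)
  define e1 where "e1 = \<eta> t1 + 1"
  have e1: "e1 > 0" "\<eta> t1 \<le> e1" using eta_nonneg[of t1] t1 by (auto simp: e1_def)
  define c where "c = mdist Y (f u) (f v) / (2 * e1)"
  have "f u \<noteq> f v" using finj two by (meson inj_onD)
  then have "mdist Y (f u) (f v) > 0" using fY two by (simp add: order_less_le)
  then have c: "c > 0" using e1 by (simp add: c_def)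
  have apart: "c \<le> mdist Y (f x) (f w)" if x: "x \<in> K" and w: "w \<in> mspace X" "s0 \<le> mdist X x w" for x w
  proof -
    have xX: "x \<in> mspace X" and xu: "mdist X x u \<le> R"
      using x mdist_commute[of X x u] by (auto simp: K_def)
    have "mdist X x v \<le> mdist X x u + mdist X u v" using xX two by (intro mdist_triangle)
    then have xv: "mdist X x v \<le> R + D" using xu by (simp add: D_def)
    have "R + D = t1 * s0" using s0 by (simp add: t1_def)
    also have "\<dots> \<le> t1 * mdist X x w" using t1 w(2) by (intro mult_left_mono) auto
    finally have t: "mdist X x u \<le> t1 * mdist X x w" "mdist X x v \<le> t1 * mdist X x w"
      using xu xv D by auto
    have le: "\<eta> t1 * mdist Y (f x) (f w) \<le> e1 * mdist Y (f x) (f w)"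
      using e1 by (intro mult_right_mono) auto
    have "mdist Y (f x) (f u) \<le> e1 * mdist Y (f x) (f w)"
      using qsf[rule_format, OF xX two(1) w(1), of t1] t t1 le by linarith
    moreover have "mdist Y (f x) (f v) \<le> e1 * mdist Y (f x) (f w)"
      using qsf[rule_format, OF xX two(2) w(1), of t1] t t1 le by linarith
    moreover have "mdist Y (f u) (f v) \<le> mdist Y (f x) (f u) + mdist Y (f x) (f v)"
      using mdist_triangle[of "f u" Y "f x" "f v"] fY two xX mdist_commute[of Y "f u" "f x"] by simp
    ultimately have "mdist Y (f u) (f v) \<le> 2 * e1 * mdist Y (f x) (f w)" by linarith
    then show ?thesis using e1 by (simp add: c_def divide_le_eq mult.commute)
  qed

  obtain t2 where t2: "t2 > 0" "\<eta> t2 \<le> 1 / 3"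
    using homeomorphism_nonneg_small[OF eta, of "1 / 3"] by auto
  have R1: "R + 1 > 0" and a1: "t2 * s0 / 2 ^ j > 0" using t2 s0 R by auto
  have "\<exists>P\<ge>0. \<forall>(J::nat set) x k. finite J \<longrightarrow> (\<forall>i\<in>J. x i \<in> mball_of X u (R + 1)) \<longrightarrow>
    (\<forall>i\<in>J. \<forall>l\<in>J. i \<noteq> l \<longrightarrow> t2 * s0 / 2 ^ j / (2 ^ j) ^ k i \<le> mdist X (x i) (x l)) \<longrightarrow>
    (\<Sum>i\<in>J. b ^ k i) \<le> P"
    unfolding b by (rule packing_sum[OF dbl two(1) R1 a1])
  then obtain P where P: "P \<ge> 0" "\<forall>(J::nat set) x k. finite J \<longrightarrow> (\<forall>i\<in>J. x i \<in> mball_of X u (R + 1)) \<longrightarrow>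
    (\<forall>i\<in>J. \<forall>l\<in>J. i \<noteq> l \<longrightarrow> t2 * s0 / 2 ^ j / (2 ^ j) ^ k i \<le> mdist X (x i) (x l)) \<longrightarrow>
    (\<Sum>i\<in>J. b ^ k i) \<le> P"
    by (elim exE conjE)

  \<comment> \<open>\<open>l\<close> and \<open>e\<close> make each of the two terms of the estimate by interpolation at most \<open>c / 16\<close>.\<close>
  define l where "l = c / (16 * (P + 1))"
  have l: "l > 0" using c P by (simp add: l_def)
  define e where "e = c / 16 * l powr al"
  have e: "e > 0" using c l by (simp add: e_def)
  have c2: "c / 2 > 0" using c by simp
  obtain I :: "nat set" and y r where I: "finite I" "\<forall>i\<in>I. y i \<in> f ` K \<and> 0 < r i \<and> r i \<le> c / 2"
    "f ` K \<subseteq> (\<Union>i\<in>I. mball_of Y (y i) (r i))" "(\<Sum>i\<in>I. r i powr (1 + al)) < e"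
    using small_ball_cover[OF H s K e c2] by (elim exE conjE)
  have yY: "\<forall>i\<in>I. y i \<in> mspace Y" and rI: "\<forall>i\<in>I. 0 \<le> r i" using I(2) fY KX by force+
  obtain J where J: "J \<subseteq> I" "\<forall>i\<in>J. \<forall>j\<in>J. i \<noteq> j \<longrightarrow> r i \<le> mdist Y (y i) (y j)"
    "(\<Union>i\<in>I. mball_of Y (y i) (r i)) \<subseteq> (\<Union>j\<in>J. mball_of Y (y j) (2 * r j))"
    using finite_vitali[OF I(1) yY rI] by (elim exE conjE)
  have finJ: "finite J" using J(1) I(1) by (rule finite_subset)
  have rJ: "0 < r i" "r i \<le> c / 2" if "i \<in> J" for i using I(2) J(1) that by auto
  have "\<forall>i\<in>J. \<exists>x. x \<in> K \<and> f x = y i"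
  proof
    fix i assume "i \<in> J"
    then have "y i \<in> f ` K" using I(2) J(1) by (meson subsetD)
    then show "\<exists>x. x \<in> K \<and> f x = y i" by (elim imageE) auto
  qed
  then obtain x where x: "\<And>i. i \<in> J \<Longrightarrow> x i \<in> K" "\<And>i. i \<in> J \<Longrightarrow> f (x i) = y i" by metis
  have xX: "x i \<in> mspace X" if "i \<in> J" for i using x(1)[OF that] KX by blast

  define inside where "inside i k \<longleftrightarrow>
    (\<forall>w\<in>mspace X. mdist Y (y i) (f w) < 2 * r i \<longrightarrow> mdist X (x i) w \<le> s0 / (2 ^ j) ^ k)" for i k
  have "\<exists>k. inside i k \<and> \<not> inside i (Suc k)" if i: "i \<in> J" for i
  proof (rule ccontr)
    assume "\<not> ?thesis"
    then have step: "inside i k \<Longrightarrow> inside i (Suc k)" for k by blast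
    have "inside i 0"
      unfolding inside_def
    proof (intro ballI impI)
      fix w assume w: "w \<in> mspace X" "mdist Y (y i) (f w) < 2 * r i"
      then have "mdist Y (f (x i)) (f w) < c" using rJ[OF i] x(2)[OF i] by simp
      then have "\<not> s0 \<le> mdist X (x i) w" using apart[OF x(1)[OF i] w(1)] by linarith
      then show "mdist X (x i) w \<le> s0 / (2 ^ j) ^ 0" by simp
    qed
    then have all: "inside i k" for k by (induction k) (use step in auto)
    define B where "B = {w \<in> topspace (mtopology_of X). f w \<in> mball_of Y (y i) (2 * r i)}"
    have "openin (mtopology_of X) B"
      unfolding B_def using fcont openin_mball_of by (rule openin_continuous_map_preimage)
    moreover have "x i \<in> B" using xX[OF i] x(2)[OF i] rJ[OF i] fY[OF xX[OF i]] by (simp add: B_def)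
    ultimately obtain d where d: "d > 0" "mball_of X (x i) d \<subseteq> B"
      unfolding mtopology_of_def mball_of_def
      using Metric_space.openin_mtopology[of "mspace X" "mdist X"] by auto
    \<comment> \<open>\<open>X\<close> is connected with more than one point, so \<open>x i\<close> is not isolated.\<close>
    obtain z where z: "z \<in> mspace X" "z \<noteq> x i" using two by metis
    have "mdist X (x i) z \<noteq> 0" using z xX[OF i] by simp
    then have xz: "0 < mdist X (x i) z" by (simp add: order_less_le)
    define d' where "d' = min (d / 2) (mdist X (x i) z)"
    have d': "d' > 0" "d' < d" "d' \<le> mdist X (x i) z"
      using d(1) xz by (auto simp: d'_def)
    then obtain w where w: "w \<in> mspace X" "mdist X (x i) w = d'"
      using connected_point_at_distance[OF conX xX[OF i] xX[OF i] z(1), of d'] xX[OF i] by auto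
    have "w \<in> B" using d(2) w d'(2) xX[OF i] by auto
    then have "mdist Y (y i) (f w) < 2 * r i" by (simp add: B_def)
    then have small: "d' \<le> s0 / (2 ^ j) ^ k" for k using all[of k] w unfolding inside_def by blast
    have "1 < (2::real) ^ j" using \<open>16 \<le> 2 ^ j\<close> by linarith
    then obtain k where "s0 / d' < (2 ^ j) ^ k" using real_arch_pow by blast
    then have "s0 / (2 ^ j) ^ k < d'" using d'(1) by (simp add: field_simps)
    then show False using small[of k] by simp
  qed
  then obtain k where k: "\<And>i. i \<in> J \<Longrightarrow> inside i (k i)" "\<And>i. i \<in> J \<Longrightarrow> \<not> inside i (Suc (k i))" by metis

  have sep: "t2 * s0 / 2 ^ j / (2 ^ j) ^ k i \<le> mdist X (x i) (x m)" if i: "i \<in> J" and m: "m \<in> J" and im: "i \<noteq> m" for i m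
  proof (rule ccontr)
    assume neg: "\<not> ?thesis"
    obtain w where w: "w \<in> mspace X" "mdist Y (y i) (f w) < 2 * r i" "s0 / (2 ^ j) ^ Suc (k i) < mdist X (x i) w"
      using k(2)[OF i] unfolding inside_def by (auto simp: not_le)
    have "mdist X (x i) (x m) < t2 * (s0 / (2 ^ j) ^ Suc (k i))" using neg by (simp add: field_simps)
    also have "\<dots> \<le> t2 * mdist X (x i) w" using w(3) t2(1) by (intro mult_left_mono) auto
    finally have "mdist Y (f (x i)) (f (x m)) \<le> \<eta> t2 * mdist Y (f (x i)) (f w)"
      using qsf[rule_format, OF xX[OF i] xX[OF m] w(1), of t2] t2(1) by simp
    also have "\<dots> \<le> 1 / 3 * mdist Y (f (x i)) (f w)" using t2(2) by (intro mult_right_mono) auto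
    finally have "mdist Y (y i) (y m) \<le> 1 / 3 * mdist Y (y i) (f w)" using x(2) i m by simp
    moreover have "r i \<le> mdist Y (y i) (y m)" using J(2) i m im by blast
    ultimately show False using w(2) rJ(1)[OF i] by linarith
  qed
  have xB: "x i \<in> mball_of X u (R + 1)" if "i \<in> J" for i using x(1)[OF that] by (auto simp: K_def)
  have bsum: "(\<Sum>i\<in>J. b ^ k i) \<le> P"
    using xB sep by (rule P(2)[rule_format, OF finJ])

  have "(\<Sum>i\<in>J. r i * q ^ k i) \<le> (\<Sum>i\<in>J. l * b ^ k i + l powr (- al) * r i powr (1 + al))"
    using qb l rJ(1) al by (intro sum_mono weight_dichotomy) auto
  also have "\<dots> = l * (\<Sum>i\<in>J. b ^ k i) + l powr (- al) * (\<Sum>i\<in>J. r i powr (1 + al))"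
    by (simp add: sum.distrib sum_distrib_left)
  also have "\<dots> \<le> l * P + l powr (- al) * e"
  proof (intro add_mono mult_left_mono)
    have "(\<Sum>i\<in>J. r i powr (1 + al)) \<le> (\<Sum>i\<in>I. r i powr (1 + al))"
      using I(1) J(1) by (intro sum_mono2) auto
    then show "(\<Sum>i\<in>J. r i powr (1 + al)) \<le> e" using I(4) by linarith
  qed (use bsum l in auto)
  also have "l powr (- al) * e = c / 16" using l by (simp add: e_def powr_minus field_simps)
  also have "l * P \<le> c / 16" using c P(1) by (simp add: l_def field_simps)
  finally have total: "(\<Sum>i\<in>J. r i * q ^ k i) \<le> c / 8" by simp

  obtain G' a' v' where G': "connectedin (mtopology_of X) G'" "\<forall>y\<in>G'. \<exists>u\<in>G. mdist X u y \<le> 6 * L * s0"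
    "a' \<in> G'" "v' \<in> G'" "D / 4 \<le> mdist X a' v'"
    "(\<Sum>i\<in>{i\<in>J. \<exists>y\<in>G'. mdist X (x i) y \<le> s0 / (2 ^ j) ^ k i}. r i)
      \<le> (\<Sum>i\<in>{i\<in>J. \<exists>y\<in>G. mdist X (x i) y < 8 * L * s0}. r i * (1 - 1 / real (N ^ j)) ^ k i)"
    using multiscale_avoidance[OF alc dbl j finJ, of x r G s0 "D / 4" a v k] xX rJ(1) G(1,2) s0 D av
    by (auto simp: less_imp_le)
  have G'K: "G' \<subseteq> K"
  proof
    fix y assume y: "y \<in> G'"
    then obtain z where z: "z \<in> G" "mdist X z y \<le> 6 * L * s0" using G'(2) by blast
    have yX: "y \<in> mspace X" using y connectedin_mspace[OF G'(1)] by blast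
    have "mdist X u y \<le> mdist X u z + mdist X z y" using z GX yX two by (intro mdist_triangle) auto
    then show "y \<in> K" using z GB[OF z(1)] yX two by (simp add: K_def R_def)
  qed
  define J' where "J' = {i\<in>J. \<exists>y\<in>G'. mdist X (x i) y \<le> s0 / (2 ^ j) ^ k i}"
  have "(\<Sum>i\<in>J'. r i) \<le> (\<Sum>i\<in>{i\<in>J. \<exists>y\<in>G. mdist X (x i) y < 8 * L * s0}. r i * q ^ k i)"
    using G'(6) unfolding J'_def q .
  also have "\<dots> \<le> (\<Sum>i\<in>J. r i * q ^ k i)"
    using finJ rJ(1) qb by (intro sum_mono2) (auto simp: less_imp_le)
  finally have light: "(\<Sum>i\<in>J'. r i) \<le> c / 8" using total by linarith

  have "connectedin (mtopology_of Y) (f ` G')" using fcont G'(1) by (rule connectedin_continuous_map_image)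
  moreover have "f ` G' \<subseteq> (\<Union>i\<in>J'. mball_of Y (y i) (2 * r i))"
  proof clarify
    fix z assume z: "z \<in> G'"
    then have "f z \<in> f ` K" using G'K by blast
    then obtain i where i: "i \<in> J" "f z \<in> mball_of Y (y i) (2 * r i)" using I(3) J(3) by blast
    have "mdist X (x i) z \<le> s0 / (2 ^ j) ^ k i"
      using k(1)[OF i(1)] i(2) z G'K KX unfolding inside_def by auto
    then have "i \<in> J'" using i(1) z by (auto simp: J'_def)
    then show "f z \<in> (\<Union>i\<in>J'. mball_of Y (y i) (2 * r i))" using i(2) by blast
  qed
  moreover have "finite J'" "\<forall>i\<in>J'. y i \<in> mspace Y" "\<forall>i\<in>J'. 0 \<le> 2 * r i"
    using finJ J(1) yY rJ(1) by (auto simp: J'_def less_imp_le)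
  ultimately have "mdist Y (f a') (f v') \<le> (\<Sum>i\<in>J'. 2 * (2 * r i))"
    using G'(3,4) by (intro connected_dist_le_cover[of Y "f ` G'" J' y "\<lambda>i. 2 * r i"]) auto
  also have "\<dots> = 4 * (\<Sum>i\<in>J'. r i)" by (simp add: sum_distrib_left)
  also have "\<dots> \<le> c / 2" using light by simp
  finally have "mdist Y (f a') (f v') \<le> c / 2" .
  moreover have "c \<le> mdist Y (f a') (f v')"
    using apart[of a' v'] G'(3,4,5) G'K KX D by (auto simp: s0_def)
  ultimately show False using c by linarith
qed

lemma doubling_mono:
  assumes "doubling N X" "N \<le> N'"
  shows "doubling N' X"
  using assms unfolding doubling_def by (meson order_trans)

text \<open>Replacing \<open>N\<close> by \<open>max N 2\<close> ensures that there are at least two colours, so that \<open>q > 0\<close>.\<close>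

lemma conformal_dim_lower_bound:
  fixes N :: nat and L :: real
  shows "\<exists>C>1. conformal_dim_bound TYPE('a) N L C"
proof -
  define N' where "N' = max N 2"
  obtain j where j: "16 * L\<^sup>2 < 2 ^ j" using real_arch_pow[of 2 "16 * L\<^sup>2"] by auto
  \<comment> \<open>The exponent \<open>j + 1\<close> is positive even for small \<open>L\<close>, so the power of \<open>N'\<close> is at least \<open>2\<close>.\<close>
  define q where "q = 1 - 1 / real (N' ^ (j + 1))"
  define b where "b = 1 / (4 * real (N' ^ (j + 1)))"
  define al where "al = ln q / ln (b / q)"
  have M: "2 \<le> real (N' ^ (j + 1))" by (rule two_le_power) (simp_all add: N'_def)
  have qb: "1 / 2 \<le> q" "q < 1" "0 < b" "b \<le> 1 / 8"
    unfolding q_def b_def using reciprocal_bounds[OF M] by simp_all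
  have "ln q < 0" "ln (b / q) < 0" using qb by (simp_all add: divide_less_eq)
  then have al: "al > 0" by (simp add: al_def divide_neg_neg)
  have "(2::real) ^ j \<le> 2 ^ (j + 1)" by simp
  with j have "16 * L\<^sup>2 \<le> 2 ^ (j + 1)" by linarith
  note nz = hausdorff_measure_quasi_symmetric_nonzero[OF _ _ _ _ this _ _ _ _ q_def b_def al_def]
  have "conformal_dim_bound TYPE('a) N L (1 + al)"
    unfolding conformal_dim_bound_def conformal_dim_def hausdorff_dim_def
  proof (intro allI impI INF_greatest)
    fix X Y :: "'a metric" and s :: real
    assume X: "(\<exists>x\<in>mspace X. \<exists>y\<in>mspace X. x \<noteq> y) \<and>
        mcomplete_of X \<and> doubling N X \<and> annularly_linearly_connected L X"
      and Y: "Y \<in> {Y. quasi_symmetric X Y}" and s: "s \<in> {s. 0 \<le> s \<and> hausdorff_measure Y s = 0}"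
    obtain u v where uv: "u \<in> mspace X" "v \<in> mspace X" "u \<noteq> v" using X by blast
    have dbl: "doubling N' X" using X by (simp add: N'_def doubling_mono[of N X "max N 2"])
    have N2: "N' \<ge> 2" by (simp add: N'_def)
    have "\<not> s < 1 + al"
    proof
      assume "s < 1 + al"
      then have "hausdorff_measure Y s \<noteq> 0"
        using X Y s by (intro nz[OF _ dbl N2 _ uv]) simp_all
      then show False using s by simp
    qed
    then show "ennreal (1 + al) \<le> ennreal s" by (intro ennreal_leI) simp
  qed
  then show ?thesis using al by (intro exI[of _ "1 + al"]) simp
qed

section \<open>Isometric copies\<close>

definition isometry_onto :: "'a metric \<Rightarrow> 'b metric \<Rightarrow> ('a \<Rightarrow> 'b) \<Rightarrow> bool" where
  "isometry_onto X Y g \<longleftrightarrow> g ` mspace X = mspace Y \<and>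
     (\<forall>x\<in>mspace X. \<forall>y\<in>mspace X. mdist Y (g x) (g y) = mdist X x y)"

lemma isometry_ontoD:
  assumes "isometry_onto X Y g"
  shows "\<And>x. x \<in> mspace X \<Longrightarrow> g x \<in> mspace Y"
    "\<And>x y. x \<in> mspace X \<Longrightarrow> y \<in> mspace X \<Longrightarrow> mdist Y (g x) (g y) = mdist X x y"
    "\<And>y. y \<in> mspace Y \<Longrightarrow> \<exists>x\<in>mspace X. y = g x"
    "g ` mspace X = mspace Y"
  using assms by (auto simp: isometry_onto_def)

lemma isometry_onto_inj:
  assumes "isometry_onto X Y g"
  shows "inj_on g (mspace X)"
proof (rule inj_onI)
  fix x y assume xy: "x \<in> mspace X" "y \<in> mspace X" "g x = g y"
  then have "mdist X x y = mdist Y (g x) (g x)" using isometry_ontoD(2)[OF assms, of x y] by simp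
  also have "\<dots> = 0" using isometry_ontoD(1)[OF assms xy(1)] by simp
  finally show "x = y" using xy by simp
qed

lemma isometry_onto_inv:
  assumes "isometry_onto X Y g"
  shows "isometry_onto Y X (inv_into (mspace X) g)"
proof -
  note inj = isometry_onto_inj[OF assms]
  have "inv_into (mspace X) g ` mspace Y = mspace X"
    using isometry_ontoD(4)[OF assms] inj by (metis inv_into_image_cancel subset_refl)
  moreover have "mdist X (inv_into (mspace X) g x) (inv_into (mspace X) g y) = mdist Y x y"
    if xy: "x \<in> mspace Y" "y \<in> mspace Y" for x y
  proof -
    obtain x' y' where "x' \<in> mspace X" "x = g x'" "y' \<in> mspace X" "y = g y'"
      using isometry_ontoD(3)[OF assms] xy by meson
    then show ?thesis using isometry_ontoD(2)[OF assms] inj by simp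
  qed
  ultimately show ?thesis by (simp add: isometry_onto_def)
qed

lemma isometry_onto_homeomorphic_map:
  assumes "isometry_onto X Y g"
  shows "homeomorphic_map (mtopology_of X) (mtopology_of Y) g"
proof -
  interpret Metric_space12 "mspace X" "mdist X" "mspace Y" "mdist Y"
    by (simp add: Metric_space12_def)
  show ?thesis
    unfolding mtopology_of_def
    using isometry_ontoD[OF assms] by (intro isometry_imp_homeomorphic_map)
qed

lemma isometric_copy_exists:
  assumes "inj_on g (mspace X)"
  shows "\<exists>Y. isometry_onto X Y g"
proof -
  define h where "h = inv_into (mspace X) g"
  have h: "h (g x) = x" if "x \<in> mspace X" for x using assms that by (simp add: h_def)
  interpret Y: Metric_space "g ` mspace X" "\<lambda>a b. mdist X (h a) (h b)"
  proof
    show "mdist X (h x) (h y) = mdist X (h y) (h x)" for x y by (rule mdist_commute)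
    fix x y z assume "x \<in> g ` mspace X" "y \<in> g ` mspace X"
    then obtain x' y' where xy: "x' \<in> mspace X" "x = g x'" "y' \<in> mspace X" "y = g y'" by blast
    show "(mdist X (h x) (h y) = 0) = (x = y)"
      using xy h inj_on_eq_iff[OF assms] by simp
    assume "z \<in> g ` mspace X"
    then obtain z' where "z' \<in> mspace X" "z = g z'" by blast
    then show "mdist X (h x) (h z) \<le> mdist X (h x) (h y) + mdist X (h y) (h z)"
      using xy h by (simp add: mdist_triangle)
  qed simp
  have "isometry_onto X (metric (g ` mspace X, \<lambda>a b. mdist X (h a) (h b))) g"
    by (simp add: isometry_onto_def h)
  then show ?thesis by blast
qed

lemma isometry_onto_mball:
  assumes "isometry_onto X Y g" "x \<in> mspace X"
  shows "g ` mball_of X x r = mball_of Y (g x) r"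
proof
  show "g ` mball_of X x r \<subseteq> mball_of Y (g x) r"
    using isometry_ontoD(1,2)[OF assms(1)] assms(2) by auto
  show "mball_of Y (g x) r \<subseteq> g ` mball_of X x r"
  proof
    fix y assume y: "y \<in> mball_of Y (g x) r"
    then obtain z where "z \<in> mspace X" "y = g z" using isometry_ontoD(3)[OF assms(1)] by force
    then show "y \<in> g ` mball_of X x r"
      using y isometry_ontoD(2)[OF assms(1) assms(2), of z] assms(2) by auto
  qed
qed

lemma isometry_onto_doubling:
  assumes iso: "isometry_onto X Y g" and dbl: "doubling N X"
  shows "doubling N Y"
  unfolding doubling_def
proof (intro ballI allI impI)
  fix y and r :: real assume "y \<in> mspace Y" and r: "0 < r"
  then obtain x where x: "x \<in> mspace X" "y = g x" using isometry_ontoD(3)[OF iso] by blast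
  obtain F where F: "F \<subseteq> mspace X" "finite F" "card F \<le> N" "mball_of X x r \<subseteq> (\<Union>z\<in>F. mball_of X z (r / 2))"
    using dbl[unfolded doubling_def, rule_format, OF x(1) r] by (elim exE conjE)
  show "\<exists>F. F \<subseteq> mspace Y \<and> finite F \<and> card F \<le> N \<and> mball_of Y y r \<subseteq> (\<Union>z\<in>F. mball_of Y z (r / 2))"
  proof (intro exI[of _ "g ` F"] conjI)
    show "g ` F \<subseteq> mspace Y" using F(1) isometry_ontoD(1)[OF iso] by blast
    show "card (g ` F) \<le> N" using card_image_le[OF F(2), of g] F(3) by linarith
    have "mball_of Y y r = g ` mball_of X x r" using isometry_onto_mball[OF iso x(1)] x(2) by simp
    also have "\<dots> \<subseteq> (\<Union>z\<in>F. g ` mball_of X z (r / 2))" using F(4) by blast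
    also have "\<dots> = (\<Union>z\<in>g ` F. mball_of Y z (r / 2))"
      using isometry_onto_mball[OF iso] F(1) by (auto simp: subset_iff)
    finally show "mball_of Y y r \<subseteq> (\<Union>z\<in>g ` F. mball_of Y z (r / 2))" .
  qed (use F in simp)
qed

lemma isometry_onto_mcomplete:
  assumes iso: "isometry_onto X Y g" and comp: "mcomplete_of X"
  shows "mcomplete_of Y"
proof -
  interpret X: Metric_space "mspace X" "mdist X" by simp
  interpret Y: Metric_space "mspace Y" "mdist Y" by simp
  define h where "h = inv_into (mspace X) g"
  have ih: "isometry_onto Y X h" unfolding h_def using iso by (rule isometry_onto_inv)
  have gh: "g (h y) = y" if "y \<in> mspace Y" for y
    using that isometry_ontoD(4)[OF iso] by (simp add: h_def f_inv_into_f)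
  have "continuous_map (mtopology_of X) (mtopology_of Y) g"
    using isometry_onto_homeomorphic_map[OF iso] by (rule homeomorphic_imp_continuous_map)
  then have cont: "continuous_map X.mtopology Y.mtopology g" by (simp add: mtopology_of_def)
  have "Y.mcomplete"
    unfolding Y.mcomplete_def
  proof (intro allI impI)
    fix \<sigma> assume "Y.MCauchy \<sigma>"
    then have \<sigma>: "range \<sigma> \<subseteq> mspace Y" "\<forall>\<epsilon>>0. \<exists>N. \<forall>n n'. N \<le> n \<longrightarrow> N \<le> n' \<longrightarrow> mdist Y (\<sigma> n) (\<sigma> n') < \<epsilon>"
      by (auto simp: Y.MCauchy_def)
    have "mdist X (h (\<sigma> n)) (h (\<sigma> n')) = mdist Y (\<sigma> n) (\<sigma> n')" for n n'
      using \<sigma>(1) isometry_ontoD(2)[OF ih] by blast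
    moreover have "range (h \<circ> \<sigma>) \<subseteq> mspace X" using \<sigma>(1) isometry_ontoD(1)[OF ih] by auto
    ultimately have "X.MCauchy (h \<circ> \<sigma>)" using \<sigma>(2) by (simp add: X.MCauchy_def)
    then obtain x where "limitin X.mtopology (h \<circ> \<sigma>) x sequentially"
      using comp unfolding mcomplete_of_def X.mcomplete_def by blast
    with cont have "limitin Y.mtopology (g \<circ> (h \<circ> \<sigma>)) (g x) sequentially"
      by (rule continuous_map_limit)
    moreover have "g \<circ> (h \<circ> \<sigma>) = \<sigma>" using gh \<sigma>(1) by (auto simp: fun_eq_iff)
    ultimately show "\<exists>x. limitin Y.mtopology \<sigma> x sequentially" by auto
  qed
  then show ?thesis by (simp add: mcomplete_of_def)
qed

lemma isometry_onto_annulus: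
  assumes iso: "isometry_onto X Y g" and "p \<in> mspace X" "x \<in> mspace X"
  shows "g x \<in> annulus Y (g p) r R \<longleftrightarrow> x \<in> annulus X p r R"
  using isometry_ontoD(1,2)[OF iso] assms(2,3) by (simp add: annulus_def)

lemma isometry_onto_alc:
  assumes iso: "isometry_onto X Y g" and alc: "annularly_linearly_connected L X"
  shows "annularly_linearly_connected L Y"
  unfolding annularly_linearly_connected_def
proof (intro conjI ballI allI impI)
  show "L \<ge> 1" using alc by (simp add: annularly_linearly_connected_def)
  have hom: "homeomorphic_map (mtopology_of X) (mtopology_of Y) g"
    using iso by (rule isometry_onto_homeomorphic_map)
  show "connected_space (mtopology_of Y)"
    using alc homeomorphic_connected_space[OF homeomorphic_map_imp_homeomorphic_space[OF hom]]
    by (simp add: annularly_linearly_connected_def)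
  show "mcomplete_of Y"
    by (rule isometry_onto_mcomplete[OF iso]) (use alc in \<open>simp add: annularly_linearly_connected_def\<close>)
  fix p' r x' y'
  assume p': "p' \<in> mspace Y" and r: "0 < r" and x': "x' \<in> annulus Y p' r (2 * r)"
    and y': "y' \<in> annulus Y p' r (2 * r)" and ne: "x' \<noteq> y'"
  have "x' \<in> mspace Y" "y' \<in> mspace Y" using x' y' by (auto simp: annulus_def)
  then obtain p x y where pxy: "p \<in> mspace X" "p' = g p" "x \<in> mspace X" "x' = g x" "y \<in> mspace X" "y' = g y"
    using isometry_ontoD(3)[OF iso] p' by meson
  have "x \<in> annulus X p r (2 * r)" "y \<in> annulus X p r (2 * r)" "x \<noteq> y"
    using x' y' ne isometry_onto_annulus[OF iso] pxy by auto
  then obtain J where J: "arc_joining X x y J" "J \<subseteq> annulus X p (r / L) (2 * L * r)"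
    using alc pxy(1) r unfolding annularly_linearly_connected_def by meson
  from J(1) obtain h where h: "embedding_map (top_of_set {0..1::real}) (mtopology_of X) h"
    "h 0 = x" "h 1 = y" "h ` {0..1} = J" unfolding arc_joining_def by blast
  have "embedding_map (mtopology_of X) (mtopology_of Y) g"
    unfolding embedding_map_def homeomorphic_imp_surjective_map[OF hom] subtopology_topspace
    by (rule hom)
  with h(1) have "embedding_map (top_of_set {0..1::real}) (mtopology_of Y) (g \<circ> h)"
    by (rule embedding_map_compose)
  moreover have "(g \<circ> h) ` {0..1} = g ` J" unfolding h(4)[symmetric] by (rule image_comp[symmetric])
  ultimately have "arc_joining Y x' y' (g ` J)"
    unfolding arc_joining_def using h(2,3) pxy by (intro exI[of _ "g \<circ> h"]) simp
  moreover have "g ` J \<subseteq> annulus Y p' (r / L) (2 * L * r)"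
  proof clarify
    fix z assume "z \<in> J"
    then have "z \<in> annulus X p (r / L) (2 * L * r)" using J(2) by blast
    moreover have "z \<in> mspace X" using calculation by (auto simp: annulus_def)
    ultimately show "g z \<in> annulus Y p' (r / L) (2 * L * r)"
      using isometry_onto_annulus[OF iso pxy(1)] pxy(2) by simp
  qed
  ultimately show "\<exists>J. arc_joining Y x' y' J \<and> J \<subseteq> annulus Y p' (r / L) (2 * L * r)" by blast
qed

lemma isometry_onto_hausdorff_content:
  assumes iso: "isometry_onto X Y g"
  shows "hausdorff_content Y s \<delta> \<le> hausdorff_content X s \<delta>"
  unfolding hausdorff_content_def
proof (rule INF_mono)
  fix U assume "U \<in> {U. mspace X \<subseteq> (\<Union>i::nat. U i) \<and> (\<forall>i. U i \<subseteq> mspace X \<and> ediam X (U i) \<le> ennreal \<delta>)}"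
  then have U: "mspace X \<subseteq> (\<Union>i. U i)" "\<And>i. U i \<subseteq> mspace X" "\<And>i. ediam X (U i) \<le> ennreal \<delta>"
    by blast+
  have ed: "ediam Y (g ` U i) = ediam X (U i)" for i
    unfolding ediam_def image_image
    using U(2)[of i] isometry_ontoD(2)[OF iso] by (intro SUP_cong refl) (simp add: subset_iff)
  have "diam_power Y s (g ` U i) = diam_power X s (U i)" for i
    by (simp add: diam_power_def ed)
  moreover have "g ` mspace X \<subseteq> g ` (\<Union>i. U i)" using U(1) by (rule image_mono)
  then have "mspace Y \<subseteq> (\<Union>i. g ` U i)" by (simp add: isometry_ontoD(4)[OF iso] image_UN)
  moreover have "g ` U i \<subseteq> mspace Y" for i using U(2)[of i] isometry_ontoD(1)[OF iso] by (meson image_subsetI subsetD)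
  ultimately show "\<exists>V\<in>{V. mspace Y \<subseteq> (\<Union>i::nat. V i) \<and> (\<forall>i. V i \<subseteq> mspace Y \<and> ediam Y (V i) \<le> ennreal \<delta>)}.
      (\<Sum>i. diam_power Y s (V i)) \<le> (\<Sum>i. diam_power X s (U i))"
    using U(3) by (intro bexI[of _ "\<lambda>i. g ` U i"]) (auto simp: ed)
qed

lemma isometry_onto_hausdorff_dim:
  assumes "isometry_onto X Y g"
  shows "hausdorff_dim Y \<le> hausdorff_dim X"
proof -
  have le: "hausdorff_measure Y s \<le> hausdorff_measure X s" for s
    unfolding hausdorff_measure_def
    using isometry_onto_hausdorff_content[OF assms] by (intro SUP_mono) auto
  have "hausdorff_measure Y s = 0" if "hausdorff_measure X s = 0" for s using le[of s] that by simp
  then have "{s. 0 \<le> s \<and> hausdorff_measure X s = 0} \<subseteq> {s. 0 \<le> s \<and> hausdorff_measure Y s = 0}"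
    by blast
  then show ?thesis unfolding hausdorff_dim_def by (rule INF_superset_mono) simp
qed

lemma quasi_symmetric_map_isometry:
  assumes iso: "isometry_onto X X' g" "isometry_onto Y Y' h" and qs: "quasi_symmetric_map X Y f"
    and eq: "\<And>x. x \<in> mspace X \<Longrightarrow> f' (g x) = h (f x)"
  shows "quasi_symmetric_map X' Y' f'"
proof -
  have f: "homeomorphic_map (mtopology_of X) (mtopology_of Y) f"
    using qs by (simp add: quasi_symmetric_map_def)
  obtain \<eta> \<theta> where \<eta>: "homeomorphism {0..} {0..} \<eta> \<theta>"
    "\<forall>x\<in>mspace X. \<forall>a\<in>mspace X. \<forall>b\<in>mspace X. \<forall>t\<ge>0. mdist X x a \<le> t * mdist X x b \<longrightarrow>
           mdist Y (f x) (f a) \<le> \<eta> t * mdist Y (f x) (f b)"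
    using qs unfolding quasi_symmetric_map_def by (elim exE conjE)
  have fY: "f x \<in> mspace Y" if "x \<in> mspace X" for x
    using homeomorphic_imp_surjective_map[OF f] that by auto
  define k where "k = inv_into (mspace X) g"
  have "homeomorphic_map (mtopology_of X') (mtopology_of X) k"
    unfolding k_def using isometry_onto_homeomorphic_map isometry_onto_inv iso(1) by blast
  with f have "homeomorphic_map (mtopology_of X') (mtopology_of Y) (f \<circ> k)"
    by (metis homeomorphic_map_compose)
  then have "homeomorphic_map (mtopology_of X') (mtopology_of Y') (h \<circ> (f \<circ> k))"
    using isometry_onto_homeomorphic_map[OF iso(2)] by (rule homeomorphic_map_compose)
  moreover have "(h \<circ> (f \<circ> k)) x = f' x" if x: "x \<in> topspace (mtopology_of X')" for x
  proof -
    obtain z where "z \<in> mspace X" "x = g z" using isometry_ontoD(3)[OF iso(1)] x by auto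
    then show ?thesis using eq isometry_onto_inj[OF iso(1)] by (simp add: k_def)
  qed
  ultimately have "homeomorphic_map (mtopology_of X') (mtopology_of Y') f'"
    by (rule homeomorphic_map_eq)
  moreover have "mdist Y' (f' x) (f' a) \<le> \<eta> t * mdist Y' (f' x) (f' b)"
    if mem: "x \<in> mspace X'" "a \<in> mspace X'" "b \<in> mspace X'" and t: "t \<ge> 0" and le: "mdist X' x a \<le> t * mdist X' x b"
    for x a b t
  proof -
    obtain x1 a1 b1 where xab: "x1 \<in> mspace X" "x = g x1" "a1 \<in> mspace X" "a = g a1" "b1 \<in> mspace X" "b = g b1"
      using isometry_ontoD(3)[OF iso(1)] mem by meson
    have "mdist X x1 a1 \<le> t * mdist X x1 b1" using le xab isometry_ontoD(2)[OF iso(1)] by simp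
    then have "mdist Y (f x1) (f a1) \<le> \<eta> t * mdist Y (f x1) (f b1)" using \<eta>(2) xab t by simp
    then show ?thesis using xab eq fY isometry_ontoD(2)[OF iso(2)] by simp
  qed
  ultimately show ?thesis
    unfolding quasi_symmetric_map_def by (intro conjI exI[of _ \<eta>] exI[of _ \<theta>] ballI allI impI \<eta>(1)) auto
qed

text \<open>A space \<open>Y\<close> quasi-symmetric to \<open>X\<close> has as many points as \<open>X\<close>, so it has an isometric copy with the
  same points as \<open>X'\<close>; the identity is then a quasi-symmetric map from \<open>X'\<close> to this copy.\<close>

lemma conformal_dim_isometric_copy_le:
  fixes X :: "'a metric" and X' :: "'b metric"
  assumes iso: "isometry_onto X X' g"
  shows "conformal_dim X' \<le> conformal_dim X"
  unfolding conformal_dim_def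
proof (rule INF_mono)
  fix Y :: "'a metric" assume "Y \<in> {Y. quasi_symmetric X Y}"
  then obtain f where f: "quasi_symmetric_map X Y f" by (auto simp: quasi_symmetric_def)
  then have hom: "homeomorphic_map (mtopology_of X) (mtopology_of Y) f"
    by (simp add: quasi_symmetric_map_def)
  have finj: "inj_on f (mspace X)" and fim: "f ` mspace X = mspace Y"
    using homeomorphic_imp_injective_map[OF hom] homeomorphic_imp_surjective_map[OF hom] by auto
  define h where "h = g \<circ> inv_into (mspace X) f"
  have hf: "h (f x) = g x" if "x \<in> mspace X" for x using finj that by (simp add: h_def)
  have "inj_on h (mspace Y)"
    unfolding fim[symmetric] using hf finj isometry_onto_inj[OF iso]
    by (auto simp: inj_on_def)
  then obtain Y' :: "'b metric" where Y': "isometry_onto Y Y' h" using isometric_copy_exists by blast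
  have "quasi_symmetric_map X' Y' id"
    using iso Y' f by (rule quasi_symmetric_map_isometry) (simp add: hf)
  then have "quasi_symmetric X' Y'" unfolding quasi_symmetric_def by blast
  then show "\<exists>Z\<in>{Z :: 'b metric. quasi_symmetric X' Z}. hausdorff_dim Z \<le> hausdorff_dim Y"
    using isometry_onto_hausdorff_dim[OF Y'] by (intro bexI[of _ Y']) simp_all
qed

text \<open>The balls around a fixed point have finite nets of every mesh. A point is determined by the net
  points that are within the mesh size of it, which is a subset of a countable set.\<close>

lemma doubling_inj_real:
  assumes dbl: "doubling N X"
  shows "\<exists>g :: 'a \<Rightarrow> real. inj_on g (mspace (X :: 'a metric))"
proof (cases "mspace X = {}")
  case False
  then obtain p where p: "p \<in> mspace X" by blast
  have "\<exists>F. finite F \<and> F \<subseteq> mspace X \<and> mball_of X p (real (Suc n)) \<subseteq> (\<Union>y\<in>F. mball_of X y (1 / real (Suc n)))" for n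
  proof -
    define R where "R = real (Suc n)"
    have R: "R > 0" by (simp add: R_def)
    obtain m where "R * R < 2 ^ m" using real_arch_pow[of 2 "R * R"] by auto
    then have m: "R / 2 ^ m \<le> 1 / R" using R by (simp add: field_simps)
    obtain F where F: "F \<subseteq> mspace X" "finite F" "card F \<le> N ^ m" "mball_of X p R \<subseteq> (\<Union>y\<in>F. mball_of X y (R / 2 ^ m))"
      using doubling_iterate[OF dbl p R, of m] by (elim exE conjE)
    have "mball_of X y (R / 2 ^ m) \<subseteq> mball_of X y (1 / R)" for y using m by auto
    then have "mball_of X p R \<subseteq> (\<Union>y\<in>F. mball_of X y (1 / R))" using F(4) by blast
    then show ?thesis using F unfolding R_def by blast
  qed
  then obtain F where F: "\<And>n. finite (F n)" "\<And>n. F n \<subseteq> mspace X"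
    "\<And>n. mball_of X p (real (Suc n)) \<subseteq> (\<Union>y\<in>F n. mball_of X y (1 / real (Suc n)))" by metis
  define E where "E = (SIGMA n:UNIV. F n)"
  have "countable E" unfolding E_def using F(1) by (intro countable_SIGMA) (auto intro: countable_finite)
  then obtain c :: "nat \<times> 'a \<Rightarrow> nat" where c: "inj_on c E" by (auto simp: countable_def)
  obtain \<phi> :: "nat set \<Rightarrow> real" where \<phi>: "inj \<phi>"
    using nat_sets_eqpoll_reals by (auto simp: eqpoll_def bij_betw_def)
  define A where "A x = {e \<in> E. mdist X (snd e) x < 1 / real (Suc (fst e))}" for x
  have "inj_on (\<lambda>x. \<phi> (c ` A x)) (mspace X)"
  proof (rule inj_onI, rule ccontr)
    fix x y assume x: "x \<in> mspace X" and y: "y \<in> mspace X" and eq: "\<phi> (c ` A x) = \<phi> (c ` A y)" and ne: "x \<noteq> y"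
    have "c ` A x = c ` A y" using eq \<phi> by (simp add: inj_eq)
    moreover have "A x \<subseteq> E" "A y \<subseteq> E" by (auto simp: A_def)
    ultimately have A: "A x = A y" using c by (simp add: inj_on_image_eq_iff)
    have "mdist X x y \<noteq> 0" using x y ne by simp
    then have d: "mdist X x y > 0" by (simp add: order_less_le)
    obtain n where n: "max (mdist X p x) (2 / mdist X x y) < real n" using reals_Archimedean2 by blast
    have "x \<in> mball_of X p (real (Suc n))" using n x p by simp
    then obtain z where z: "z \<in> F n" "x \<in> mball_of X z (1 / real (Suc n))" using F(3) by blast
    then have "(n, z) \<in> A x" by (simp add: A_def E_def)
    then have "(n, z) \<in> A y" using A by simp
    then have zy: "mdist X z y < 1 / real (Suc n)" by (simp add: A_def)
    have "2 / mdist X x y < real (Suc n)" using n by simp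
    then have "2 * (1 / real (Suc n)) < mdist X x y" using d by (simp add: field_simps)
    moreover have "mdist X x y \<le> mdist X x z + mdist X z y"
      using x y z by (intro mdist_triangle) auto
    moreover have "mdist X x z < 1 / real (Suc n)" unfolding mdist_commute[of X x z] using z(2) by simp
    ultimately show False using zy by linarith
  qed
  then show ?thesis by blast
qed simp

section \<open>Independence of the point type\<close>

theorem theorem1p1:
  fixes N :: nat and L :: real
  assumes "L \<ge> 1"
  shows "(\<exists>C>1. conformal_dim_bound TYPE(real) N L C) \<and>
         (\<forall>C. conformal_dim_bound TYPE(real) N L C \<longrightarrow> conformal_dim_bound TYPE('a) N L C)"
proof (intro conjI allI impI)
  show "\<exists>C>1. conformal_dim_bound TYPE(real) N L C" by (rule conformal_dim_lower_bound)
next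
  fix C assume C: "conformal_dim_bound TYPE(real) N L C"
  show "conformal_dim_bound TYPE('a) N L C"
    unfolding conformal_dim_bound_def
  proof (intro allI impI, elim conjE bexE)
    fix X :: "'a metric" and x y
    assume X: "mcomplete_of X" "doubling N X" "annularly_linearly_connected L X"
      and xy: "x \<in> mspace X" "y \<in> mspace X" "x \<noteq> y"
    obtain g :: "'a \<Rightarrow> real" where inj: "inj_on g (mspace X)"
      using doubling_inj_real[OF X(2)] by (elim exE)
    obtain X' where iso: "isometry_onto X X' g" using isometric_copy_exists[OF inj] by (elim exE)
    have "g x \<in> mspace X'" "g y \<in> mspace X'" "g x \<noteq> g y"
      using isometry_ontoD(1)[OF iso] xy inj by (auto simp: inj_on_eq_iff)
    then have "\<exists>x\<in>mspace X'. \<exists>y\<in>mspace X'. x \<noteq> y" by (intro bexI)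
    moreover have "mcomplete_of X'" "doubling N X'" "annularly_linearly_connected L X'"
      using X isometry_onto_mcomplete[OF iso] isometry_onto_doubling[OF iso] isometry_onto_alc[OF iso]
      by simp_all
    ultimately have "ennreal C \<le> conformal_dim X'"
      using C[unfolded conformal_dim_bound_def, rule_format, of X'] by simp
    also have "\<dots> \<le> conformal_dim X" using iso by (rule conformal_dim_isometric_copy_le)
    finally show "ennreal C \<le> conformal_dim X" .
  qed
qed

end
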